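(* Let $M \in \{0,1\}^{n \times n}$ be a binary matrix with twin-width $d$. Then $M$ can be preprocessed in time $\widetilde{\mathcal{O}}_d(n^2)$ so that afterwards, for an arbitrary column vector $v \in \mathbb{R}^n$, each of the products $Mv$ and $v^\intercal M$ can be computed in time $\widetilde{\mathcal{O}}_d(n)$.
   Context: Running times are measured assuming unit-cost arithmetic operations on scalars. The notation $\widetilde{\mathcal{O}}_d(\cdot)$ hides factors polylogarithmic in $n$ and factors depending only on $d$. The preprocessing receives only the matrix $M$, with its rows and columns in arbitrary order; neither $d$ nor any ordering or merge sequence witnessing the twin-width is given. Definitions. A division of an $n\times n$ matrix $M$ is a pair $(\mathcal{R},\mathscr{C})$ of partitions of $[n]$ into contiguous non-empty intervals; the cell $(i,j)$ is the submatrix of $M$ with rows in the $i$-th interval of $\mathcal{R}$ and columns in the $j$-th interval of $\mathscr{C}$; a cell is constant if all its entries are equal. A row (resp. column) of the division is the set of cells sharing a given interval of $\mathcal{R}$ (resp. $\mathscr{C}$). A merge sequence of $M$ is a sequence of divisions $(\mathcal{R}_{2n-1},\mathscr{C}_{2n-1}),\dots,(\mathcal{R}_1,\mathscr{C}_1)$ where $\mathcal{R}_{2n-1}=\mathscr{C}_{2n-1}$ is the partition into singletons, $\mathcal{R}_1=\mathscr{C}_1=\{[n]\}$, and each division is obtained from the previous one by merging two adjacent intervals of either the row partition or the column partition (not both). It is $d$-wide if in every division every row and every column contains at most $d$ non-constant cells. $M$ is $d$-twin-ordered if it admits a $d$-wide merge sequence. The twin-width of $M$ is the smallest $d$ such that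 the rows and columns of $M$ can be (independently) permuted to yield a $d$-twin-ordered matrix. *)

theory Defs
  imports Complex_Main
begin

text \<open>A binary n x n matrix is a function nat => nat => bool whose entries
  with indices < n are relevant. Indices are 0-based: [n] is {..<n}.\<close>

definition is_interval :: "nat set \<Rightarrow> bool" where
  "is_interval A \<longleftrightarrow> (\<exists>a b. a < b \<and> A = {a..<b})"

definition interval_partition :: "nat \<Rightarrow> nat set set \<Rightarrow> bool" where
  "interval_partition n P \<longleftrightarrow>
     (\<forall>A\<in>P. is_interval A \<and> A \<subseteq> {..<n}) \<and>
     (\<forall>A\<in>P. \<forall>B\<in>P. A \<noteq> B \<longrightarrow> A \<inter> B = {}) \<and>
     \<Union>P = {..<n}"

definition singleton_partition :: "nat \<Rightarrow> nat set set" where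
  "singleton_partition n = {{i} | i. i < n}"

definition whole_partition :: "nat \<Rightarrow> nat set set" where
  "whole_partition n = (if n = 0 then {} else {{..<n}})"

definition merge_step :: "nat set set \<Rightarrow> nat set set \<Rightarrow> bool" where
  "merge_step P P' \<longleftrightarrow>
     (\<exists>A\<in>P. \<exists>B\<in>P. A \<noteq> B \<and> is_interval (A \<union> B) \<and> P' = insert (A \<union> B) (P - {A, B}))"

definition constant_cell :: "(nat \<Rightarrow> nat \<Rightarrow> bool) \<Rightarrow> nat set \<Rightarrow> nat set \<Rightarrow> bool" where
  "constant_cell M R C \<longleftrightarrow> (\<forall>i\<in>R. \<forall>j\<in>C. \<forall>i'\<in>R. \<forall>j'\<in>C. M i j = M i' j')"

text \<open>A merge sequence, indexed in the order of merging: division 0 is the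
  finest one, division 2(n-1) is the coarsest one (the paper indexes the same
  sequence downwards from 2n-1 to 1).\<close>
definition merge_sequence ::
  "nat \<Rightarrow> (nat \<Rightarrow> nat set set) \<Rightarrow> (nat \<Rightarrow> nat set set) \<Rightarrow> bool" where
  "merge_sequence n Rs Cs \<longleftrightarrow>
     (\<forall>t \<le> 2 * (n - 1). interval_partition n (Rs t) \<and> interval_partition n (Cs t)) \<and>
     Rs 0 = singleton_partition n \<and> Cs 0 = singleton_partition n \<and>
     Rs (2 * (n - 1)) = whole_partition n \<and> Cs (2 * (n - 1)) = whole_partition n \<and>
     (\<forall>t < 2 * (n - 1).
        (merge_step (Rs t) (Rs (Suc t)) \<and> Cs (Suc t) = Cs t) \<or>
        (merge_step (Cs t) (Cs (Suc t)) \<and> Rs (Suc t) = Rs t))"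

definition wide_sequence ::
  "(nat \<Rightarrow> nat \<Rightarrow> bool) \<Rightarrow> nat \<Rightarrow> nat \<Rightarrow> (nat \<Rightarrow> nat set set) \<Rightarrow> (nat \<Rightarrow> nat set set) \<Rightarrow> bool" where
  "wide_sequence M n d Rs Cs \<longleftrightarrow>
     (\<forall>t \<le> 2 * (n - 1).
        (\<forall>R\<in>Rs t. card {C\<in>Cs t. \<not> constant_cell M R C} \<le> d) \<and>
        (\<forall>C\<in>Cs t. card {R\<in>Rs t. \<not> constant_cell M R C} \<le> d))"

definition twin_ordered :: "nat \<Rightarrow> (nat \<Rightarrow> nat \<Rightarrow> bool) \<Rightarrow> nat \<Rightarrow> bool" where
  "twin_ordered n M d \<longleftrightarrow> (\<exists>Rs Cs. merge_sequence n Rs Cs \<and> wide_sequence M n d Rs Cs)"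

definition twin_width :: "nat \<Rightarrow> (nat \<Rightarrow> nat \<Rightarrow> bool) \<Rightarrow> nat" where
  "twin_width n M = (LEAST d. \<exists>\<sigma> \<tau>. bij_betw \<sigma> {..<n} {..<n} \<and> bij_betw \<tau> {..<n} {..<n} \<and>
                                   twin_ordered n (\<lambda>i j. M (\<sigma> i) (\<tau> j)) d)"

text \<open>Two register files indexed by integers: integer registers I (words,
  used for addresses and control) and real registers R (scalars). Operands
  are register indices; indirect access is via the contents of an integer
  register. Every instruction costs one time unit. There is no conversion
  from reals to integers (no floor). Word size is enforced as a bound on the
  absolute value of all integer register contents during a run.\<close>

datatype instr =
    ICONST int int
  | IADD int int int
  | ISUB int int int
  | IMUL int int int
  | IDIV int int int
  | IMOD int int int
  | ILOAD int int
  | ISTORE int int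
  | ITOR int int
  | RADD int int int
  | RSUB int int int
  | RMUL int int int
  | RDIV int int int
  | RLOAD int int
  | RSTORE int int
  | JZ int nat
  | JLT int int nat
  | RJLT int int nat
  | HALT

type_synonym state = "nat \<times> (int \<Rightarrow> int) \<times> (int \<Rightarrow> real)"

definition halted :: "instr list \<Rightarrow> state \<Rightarrow> bool" where
  "halted P s \<longleftrightarrow> (fst s \<ge> length P \<or> P ! fst s = HALT)"

fun exec :: "instr \<Rightarrow> state \<Rightarrow> state" where
  "exec (ICONST a c) (pc, I, R) = (Suc pc, I(a := c), R)"
| "exec (IADD a b c) (pc, I, R) = (Suc pc, I(a := I b + I c), R)"
| "exec (ISUB a b c) (pc, I, R) = (Suc pc, I(a := I b - I c), R)"
| "exec (IMUL a b c) (pc, I, R) = (Suc pc, I(a := I b * I c), R)"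
| "exec (IDIV a b c) (pc, I, R) = (Suc pc, I(a := I b div I c), R)"
| "exec (IMOD a b c) (pc, I, R) = (Suc pc, I(a := I b mod I c), R)"
| "exec (ILOAD a b) (pc, I, R) = (Suc pc, I(a := I (I b)), R)"
| "exec (ISTORE a b) (pc, I, R) = (Suc pc, I(I a := I b), R)"
| "exec (ITOR a b) (pc, I, R) = (Suc pc, I, R(a := real_of_int (I b)))"
| "exec (RADD a b c) (pc, I, R) = (Suc pc, I, R(a := R b + R c))"
| "exec (RSUB a b c) (pc, I, R) = (Suc pc, I, R(a := R b - R c))"
| "exec (RMUL a b c) (pc, I, R) = (Suc pc, I, R(a := R b * R c))"
| "exec (RDIV a b c) (pc, I, R) = (Suc pc, I, R(a := R b / R c))"
| "exec (RLOAD a b) (pc, I, R) = (Suc pc, I, R(a := R (I b)))"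
| "exec (RSTORE a b) (pc, I, R) = (Suc pc, I, R(I a := R b))"
| "exec (JZ a t) (pc, I, R) = ((if I a = 0 then t else Suc pc), I, R)"
| "exec (JLT a b t) (pc, I, R) = ((if I a < I b then t else Suc pc), I, R)"
| "exec (RJLT a b t) (pc, I, R) = ((if R a < R b then t else Suc pc), I, R)"
| "exec HALT s = s"

definition step :: "instr list \<Rightarrow> state \<Rightarrow> state" where
  "step P s = (if halted P s then s else exec (P ! fst s) s)"

definition run :: "instr list \<Rightarrow> nat \<Rightarrow> state \<Rightarrow> state" where
  "run P t s = (step P ^^ t) s"

definition runs_within :: "instr list \<Rightarrow> state \<Rightarrow> nat \<Rightarrow> real \<Rightarrow> state \<Rightarrow> bool" where
  "runs_within P s T B s' \<longleftrightarrow>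
     (\<exists>t \<le> T. halted P (run P t s) \<and> s' = run P t s \<and>
        (\<forall>t' \<le> t. \<forall>x. \<bar>real_of_int (fst (snd (run P t' s)) x)\<bar> \<le> B))"

definition pre_init :: "nat \<Rightarrow> (nat \<Rightarrow> nat \<Rightarrow> bool) \<Rightarrow> state" where
  "pre_init n M = (0,
     (\<lambda>x. if x = 0 then int n
          else if 1 \<le> x \<and> x \<le> int (n * n)
               then (if M (nat (x - 1) div n) (nat (x - 1) mod n) then 1 else 0)
          else 0),
     (\<lambda>_. 0))"

text \<open>Query input: starting from the memory left by preprocessing, the
  vector v is written to R (-1), ..., R (-n) (v j in R (-(j+1))), and the
  program counter is reset. The output is read from R (-1), ..., R (-n).\<close>
definition query_init :: "nat \<Rightarrow> (nat \<Rightarrow> real) \<Rightarrow> state \<Rightarrow> state" where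
  "query_init n v s = (0, fst (snd s),
     (\<lambda>x. if - int n \<le> x \<and> x \<le> -1 then v (nat (- x - 1)) else snd (snd s) x))"

definition out_reg :: "state \<Rightarrow> nat \<Rightarrow> real" where
  "out_reg s i = snd (snd s) (- int i - 1)"

definition mat_vec :: "nat \<Rightarrow> (nat \<Rightarrow> nat \<Rightarrow> bool) \<Rightarrow> (nat \<Rightarrow> real) \<Rightarrow> nat \<Rightarrow> real" where
  "mat_vec n M v i = (\<Sum>j<n. (if M i j then 1 else 0) * v j)"

definition vec_mat :: "nat \<Rightarrow> (nat \<Rightarrow> nat \<Rightarrow> bool) \<Rightarrow> (nat \<Rightarrow> real) \<Rightarrow> nat \<Rightarrow> real" where
  "vec_mat n M v j = (\<Sum>i<n. v i * (if M i j then 1 else 0))"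

end

theory Submission
  imports Defs
begin

text \<open>On any column set \<open>Q\<close>, a matrix of twin-width \<open>d\<close> has at most \<open>d 2\<^sup>d |Q| + 2\<close> distinct row
  patterns. Put the columns at the leaves of a balanced binary tree and let \<open>Q\<^sub>x\<close> be the columns
  below tree node \<open>x\<close>. The pattern of a row on \<open>Q\<^sub>x\<close> is the pair of its patterns at the two children of \<open>x\<close>,
  so giving equal patterns equal names, with a direct-address table indexed by pairs of names, turns
  the matrix into an acyclic circuit of additions. It has at most
  \<open>\<Sum>\<^sub>x (d 2\<^sup>d |Q\<^sub>x| + 2)\<close>, that is \<open>O(d 2\<^sup>d n log n)\<close>, nodes and is built in time \<open>O(n\<^sup>2)\<close> from the
  matrix in any row and column order and without knowing \<open>d\<close>. Evaluating the circuit bottom-up yields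
  \<open>M v\<close>, and pushing weights top-down through the same circuit yields \<open>v\<^sup>T M\<close>.\<close>

section \<open>Row patterns and twin-width\<close>

text \<open>The obstacle is that the merge sequence lives on an unknown ordering. It is avoided by
  bounding pattern counts on every column set, however scattered: such a count does not change when
  rows and columns are permuted, so merge sequences occur in the analysis only and never in the
  algorithm. The bound is linear in the size of the set because columns can be deleted one at a
  time, a deletion costing at most \<open>d\<close> row parts with \<open>2 ^ d\<close> patterns
  each. Linearity is what the tree needs, since each column lies below only logarithmically many
  nodes. The preprocessing does constant work for each row and each heap position, whatever
  \<open>d\<close> is; \<open>d\<close> governs only how many distinct names arise, that is, the
  size of the circuit which the queries traverse. Names are numbered in order of creation, so
  children precede parents and a single pass through the numbers suffices in either direction. The
  table of pairs occupies about \<open>n ^ 4\<close> addresses, but memory is initially zero and 0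
  means "no entry", so no time is spent on clearing it.\<close>

definition patterns :: "nat \<Rightarrow> (nat \<Rightarrow> nat \<Rightarrow> bool) \<Rightarrow> nat set \<Rightarrow> nat set set" where
  "patterns n M Q = (\<lambda>i. {j\<in>Q. M i j}) ` {..<n}"

lemma finite_patterns [simp]: "finite (patterns n M Q)"
  by (simp add: patterns_def)

lemma interval_partition_finite:
  assumes "interval_partition n P"
  shows "finite P"
proof -
  have "P \<subseteq> Pow {..<n}" using assms by (auto simp: interval_partition_def)
  then show ?thesis by (meson finite_Pow_iff finite_lessThan finite_subset)
qed

lemma interval_partition_cover:
  assumes "interval_partition n P" "x < n"
  obtains A where "A \<in> P" "x \<in> A"
  using assms unfolding interval_partition_def by blast

text \<open>If no part of \<open>C\<close> holds two columns of \<open>Q\<close>, then every column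
  of \<open>Q\<close> on which the rows of \<open>R\<close> disagree lies in its own non-constant
  cell of \<open>R\<close>. Hence at most \<open>d\<close> columns of \<open>Q\<close> vary within
  \<open>R\<close>, and a row of \<open>R\<close> is determined on \<open>Q\<close> by its entries
  in them.\<close>

lemma card_patterns_row_part:
  assumes C: "interval_partition n C" and Q: "Q \<subseteq> {..<n}"
    and sep: "\<And>A c c'. A \<in> C \<Longrightarrow> c \<in> Q \<Longrightarrow> c' \<in> Q \<Longrightarrow> c \<in> A \<Longrightarrow> c' \<in> A \<Longrightarrow> c = c'"
    and wide: "card {A\<in>C. \<not> constant_cell M R A} \<le> d"
    and fin: "finite R"
  shows "card ((\<lambda>i. {j\<in>Q. M i j}) ` R) \<le> 2 ^ d"
proof (cases "R = {}")
  case False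
  then obtain r where r: "r \<in> R" by blast
  define U where "U = {q\<in>Q. \<exists>i\<in>R. M i q \<noteq> M r q}"
  have "\<exists>A. A \<in> C \<and> q \<in> A" if "q \<in> Q" for q
    using interval_partition_cover[OF C] Q that by (metis lessThan_iff subsetD)
  then obtain p where p: "\<And>q. q \<in> Q \<Longrightarrow> p q \<in> C \<and> q \<in> p q" by metis
  have inj: "inj_on p U"
  proof (rule inj_onI)
    fix q q' assume "q \<in> U" "q' \<in> U" and e: "p q = p q'"
    then have "q \<in> Q" "q' \<in> Q" by (auto simp: U_def)
    then show "q = q'" using sep[of "p q" q q'] p[of q] p[of q'] e by simp
  qed
  have sub: "p ` U \<subseteq> {A\<in>C. \<not> constant_cell M R A}"
  proof
    fix A assume "A \<in> p ` U"
    then obtain q i where q: "q \<in> Q" "A = p q" "i \<in> R" "M i q \<noteq> M r q" by (auto simp: U_def)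
    then have "\<not> constant_cell M R A"
      unfolding constant_cell_def using p[of q] r by blast
    then show "A \<in> {A\<in>C. \<not> constant_cell M R A}" using p[of q] q by auto
  qed
  have finC: "finite {A\<in>C. \<not> constant_cell M R A}" using interval_partition_finite[OF C] by simp
  have "card U = card (p ` U)" using inj by (simp add: card_image)
  also have "\<dots> \<le> d" using card_mono[OF finC sub] wide by linarith
  finally have cU: "card U \<le> d" .
  have fU: "finite U" unfolding U_def using Q by (simp add: finite_subset)
  \<comment> \<open>Off \<open>U\<close> all rows of \<open>R\<close> copy the reference row
    \<open>r\<close>, so a pattern is a subset of \<open>U\<close> joined with one fixed
    set.\<close>
  have "(\<lambda>i. {j\<in>Q. M i j}) ` R \<subseteq> (\<lambda>X. X \<union> {j\<in>Q - U. M r j}) ` Pow U"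
  proof
    fix X assume "X \<in> (\<lambda>i. {j\<in>Q. M i j}) ` R"
    then obtain i where i: "i \<in> R" "X = {j\<in>Q. M i j}" by auto
    have "X = {j\<in>U. M i j} \<union> {j\<in>Q - U. M r j}" using i by (auto simp: U_def)
    then show "X \<in> (\<lambda>X. X \<union> {j\<in>Q - U. M r j}) ` Pow U" by blast
  qed
  then have "card ((\<lambda>i. {j\<in>Q. M i j}) ` R) \<le> card (Pow U)"
    using fU by (meson card_image_le card_mono finite_Pow_iff finite_imageI le_trans)
  also have "\<dots> \<le> 2 ^ d" using cU fU by (simp add: card_Pow)
  finally show ?thesis .
qed simp

text \<open>Take the first division in which two columns \<open>c\<close>, \<open>c'\<close> of \<open>Q\<close> share a part. Just before, the columns
  of \<open>Q\<close> lie in distinct parts, so the rows of any row part show at most \<open>2 ^ d\<close> patterns on \<open>Q\<close>.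
  Just after, \<open>c\<close> and \<open>c'\<close> agree outside at most \<open>d\<close> row parts.\<close>

lemma card_patterns_remove_column:
  assumes ms: "merge_sequence n Rs Cs" and wide: "wide_sequence M n d Rs Cs"
    and Q: "Q \<subseteq> {..<n}" and two: "card Q \<ge> 2"
  obtains c where "c \<in> Q" "card (patterns n M Q) \<le> card (patterns n M (Q - {c})) + d * 2 ^ d"
proof -
  define m where "m = 2 * (n - 1)"
  define hit where "hit t \<longleftrightarrow> (\<exists>A\<in>Cs t. \<exists>c\<in>Q. \<exists>c'\<in>Q. c \<noteq> c' \<and> c \<in> A \<and> c' \<in> A)" for t
  have part: "interval_partition n (Rs t)" "interval_partition n (Cs t)" if "t \<le> m" for t
    using ms that by (auto simp: merge_sequence_def m_def)
  have finQ: "finite Q" using Q finite_subset by blast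
  obtain x y where xy: "x \<in> Q" "y \<in> Q" "x \<noteq> y"
    using two finQ by (metis card_le_Suc0_iff_eq not_less_eq_eq numeral_2_eq_2)
  have "n \<noteq> 0" using xy Q by auto
  then have "Cs m = {{..<n}}" using ms by (simp add: merge_sequence_def whole_partition_def m_def)
  then have hm: "hit m" unfolding hit_def using xy Q by (simp; blast)
  define t where "t = (LEAST t. hit t)"
  have ht: "hit t" unfolding t_def using hm by (rule LeastI)
  have tm: "t \<le> m" unfolding t_def using hm by (rule Least_le)
  have h0: "\<not> hit 0"
    using ms by (auto simp: hit_def merge_sequence_def singleton_partition_def)
  then obtain u where u: "t = Suc u" using ht by (cases t) auto
  have hu: "\<not> hit u" using u not_less_Least[of u hit] t_def by auto
  have um: "u < m" using u tm by simp
  have "(merge_step (Rs u) (Rs t) \<and> Cs t = Cs u) \<or> (merge_step (Cs u) (Cs t) \<and> Rs t = Rs u)"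
    using ms um by (simp add: merge_sequence_def m_def u)
  \<comment> \<open>\<open>hit\<close> depends on the column partition only, so the step from
    \<open>u\<close> to \<open>t\<close> is a column merge. The row parts are therefore the same
    before and after it, which lets \<open>small\<close> count the patterns of a bad part of
    division \<open>t\<close> inside division \<open>u\<close>.\<close>
  moreover have "Cs t \<noteq> Cs u" using ht hu by (auto simp: hit_def)
  ultimately have Rtu: "Rs t = Rs u" by blast
  obtain A c c' where A: "A \<in> Cs t" "c \<in> Q" "c' \<in> Q" "c \<noteq> c'" "c \<in> A" "c' \<in> A"
    using ht by (auto simp: hit_def)
  define Bad where "Bad = {R\<in>Rs t. \<not> constant_cell M R A}"
  have cBad: "card Bad \<le> d"
    using wide tm A(1) by (simp add: wide_sequence_def Bad_def m_def)
  have finBad: "finite Bad" using interval_partition_finite[OF part(1)[OF tm]] by (simp add: Bad_def)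
  let ?pat = "\<lambda>i. {j\<in>Q. M i j}"
  have small: "card (?pat ` R) \<le> 2 ^ d" if "R \<in> Bad" for R
  proof (rule card_patterns_row_part[OF part(2) Q])
    show "u \<le> m" using um by simp
    show "c = c'" if "A \<in> Cs u" "c \<in> Q" "c' \<in> Q" "c \<in> A" "c' \<in> A" for A c c'
      using hu that unfolding hit_def by blast
    have R: "R \<in> Rs u" using that Rtu by (simp add: Bad_def)
    then show "card {A \<in> Cs u. \<not> constant_cell M R A} \<le> d"
      using wide um by (simp add: wide_sequence_def m_def)
    show "finite R" using R part(1)[of u] um unfolding interval_partition_def
      by (meson finite_lessThan finite_subset less_imp_le_nat)
  qed
  \<comment> \<open>A row outside the bad parts has equal entries in \<open>c\<close> and
    \<open>c'\<close>, so its pattern on \<open>Q - {c}\<close> determines the one on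
    \<open>Q\<close>: \<open>c\<close> is put back exactly when \<open>c'\<close> is
    present.\<close>
  have "patterns n M Q \<subseteq> (\<Union>R\<in>Bad. ?pat ` R) \<union>
      (\<lambda>X. if c' \<in> X then insert c X else X) ` patterns n M (Q - {c})"
  proof
    fix X assume "X \<in> patterns n M Q"
    then obtain i where i: "i < n" "X = ?pat i" by (auto simp: patterns_def)
    obtain R where R: "R \<in> Rs t" "i \<in> R" using interval_partition_cover[OF part(1)[OF tm] i(1)] .
    show "X \<in> (\<Union>R\<in>Bad. ?pat ` R) \<union>
      (\<lambda>X. if c' \<in> X then insert c X else X) ` patterns n M (Q - {c})"
    proof (cases "R \<in> Bad")
      case True then show ?thesis using R i by blast
    next
      case False
      then have "constant_cell M R A" using R by (simp add: Bad_def)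
      then have "M i c = M i c'" using R A unfolding constant_cell_def by blast
      then have "X = (\<lambda>X. if c' \<in> X then insert c X else X) {j\<in>Q - {c}. M i j}"
        using A i by auto
      then show ?thesis using i(1) unfolding patterns_def by blast
    qed
  qed
  moreover have finU: "finite (\<Union>R\<in>Bad. ?pat ` R)"
  proof -
    have "finite R" if "R \<in> Bad" for R
      using that part(1)[OF tm] unfolding interval_partition_def Bad_def
      by (metis (no_types, lifting) finite_lessThan finite_subset mem_Collect_eq)
    then show ?thesis using finBad by blast
  qed
  ultimately have "card (patterns n M Q) \<le> card ((\<Union>R\<in>Bad. ?pat ` R) \<union>
      (\<lambda>X. if c' \<in> X then insert c X else X) ` patterns n M (Q - {c}))"
    by (intro card_mono) auto
  also have "\<dots> \<le> card (\<Union>R\<in>Bad. ?pat ` R) +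
      card ((\<lambda>X. if c' \<in> X then insert c X else X) ` patterns n M (Q - {c}))"
    by (rule card_Un_le)
  also have "card (\<Union>R\<in>Bad. ?pat ` R) \<le> (\<Sum>R\<in>Bad. card (?pat ` R))"
    by (rule card_UN_le[OF finBad])
  also have "\<dots> \<le> (\<Sum>R\<in>Bad. 2 ^ d)" by (rule sum_mono) (rule small)
  also have "\<dots> \<le> d * 2 ^ d" using cBad by simp
  also have "card ((\<lambda>X. if c' \<in> X then insert c X else X) ` patterns n M (Q - {c}))
      \<le> card (patterns n M (Q - {c}))" by (rule card_image_le) simp
  finally show ?thesis using that A(2) by simp
qed

text \<open>Columns are deleted from \<open>Q\<close> one at a time, each deletion losing at most
  \<open>d * 2 ^ d\<close> patterns; a set of at most one column carries at most two patterns,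
  whence the \<open>+ 2\<close>.\<close>

lemma card_patterns_twin_ordered:
  assumes "twin_ordered n M d" "Q \<subseteq> {..<n}"
  shows "card (patterns n M Q) \<le> d * 2 ^ d * card Q + 2"
  using assms(2)
proof (induction "card Q" arbitrary: Q rule: less_induct)
  case less
  obtain Rs Cs where ms: "merge_sequence n Rs Cs" "wide_sequence M n d Rs Cs"
    using assms(1) by (auto simp: twin_ordered_def)
  have fin: "finite Q" using less.prems finite_subset by blast
  show ?case
  proof (cases "card Q \<ge> 2")
    case True
    obtain c where c: "c \<in> Q"
      "card (patterns n M Q) \<le> card (patterns n M (Q - {c})) + d * 2 ^ d"
      using card_patterns_remove_column[OF ms less.prems True] .
    have s: "card Q = Suc (card (Q - {c}))" using c(1) fin by (metis card_Suc_Diff1)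
    have "card (patterns n M (Q - {c})) \<le> d * 2 ^ d * card (Q - {c}) + 2"
      using s less.prems by (intro less.hyps) auto
    then show ?thesis using c(2) s by simp
  next
    case False
    have "card (patterns n M Q) \<le> card (Pow Q)"
      using fin by (intro card_mono) (auto simp: patterns_def)
    also have "\<dots> \<le> 2 ^ 1" unfolding card_Pow[OF fin] using False by (intro power_increasing) auto
    finally show ?thesis by simp
  qed
qed

text \<open>Since \<open>Q\<close> ranges over all column sets and not only over intervals, its
  preimage \<open>Q'\<close> under \<open>\<tau>\<close> is again admissible. Permuting rows merely
  reindexes the family of patterns.\<close>

lemma card_patterns_permute:
  assumes s: "bij_betw \<sigma> {..<n} {..<n}" and t: "bij_betw \<tau> {..<n} {..<n}" and Q: "Q \<subseteq> {..<n}"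
  obtains Q' where "Q' \<subseteq> {..<n}" "card Q' = card Q"
    "card (patterns n M Q) \<le> card (patterns n (\<lambda>i j. M (\<sigma> i) (\<tau> j)) Q')"
proof
  define Q' where "Q' = {j. j < n \<and> \<tau> j \<in> Q}"
  show "Q' \<subseteq> {..<n}" by (auto simp: Q'_def)
  have im: "\<tau> ` Q' = Q"
  proof
    show "Q \<subseteq> \<tau> ` Q'"
    proof
      fix q assume "q \<in> Q"
      then have "q \<in> \<tau> ` {..<n}" using Q t by (auto simp: bij_betw_def)
      then show "q \<in> \<tau> ` Q'" using \<open>q \<in> Q\<close> by (auto simp: Q'_def)
    qed
  qed (auto simp: Q'_def)
  have "inj_on \<tau> Q'" using t by (auto simp: bij_betw_def Q'_def inj_on_def)
  then show "card Q' = card Q" using im card_image by metis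
  have "patterns n M Q \<subseteq> image \<tau> ` patterns n (\<lambda>i j. M (\<sigma> i) (\<tau> j)) Q'"
  proof
    fix X assume "X \<in> patterns n M Q"
    then obtain i where i: "i < n" "X = {j\<in>Q. M i j}" by (auto simp: patterns_def)
    then have "i \<in> \<sigma> ` {..<n}" using s by (simp add: bij_betw_def)
    then obtain i' where i': "i' < n" "i = \<sigma> i'" by auto
    have "X = \<tau> ` {j\<in>Q'. M (\<sigma> i') (\<tau> j)}" using im i i' by auto
    then show "X \<in> image \<tau> ` patterns n (\<lambda>i j. M (\<sigma> i) (\<tau> j)) Q'"
      using i' unfolding patterns_def by blast
  qed
  then show "card (patterns n M Q) \<le> card (patterns n (\<lambda>i j. M (\<sigma> i) (\<tau> j)) Q')"
    by (meson card_image_le card_mono finite_imageI finite_patterns le_trans)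
qed

text \<open>The partition after \<open>k\<close> merges when the first interval always absorbs the
  next index. At \<open>n = 0\<close> it is empty, in agreement with
  \<open>whole_partition\<close>.\<close>

definition prefix_partition :: "nat \<Rightarrow> nat \<Rightarrow> nat set set" where
  "prefix_partition n k = (if n = 0 then {} else insert {..k} {{i} | i. k < i \<and> i < n})"

lemma prefix_partition_interval:
  assumes "k \<le> n - 1"
  shows "interval_partition n (prefix_partition n k)"
proof (cases "n = 0")
  case False
  have "is_interval {..k}" unfolding is_interval_def
    by (rule exI[of _ 0], rule exI[of _ "Suc k"]) auto
  moreover have "is_interval {i}" for i unfolding is_interval_def
    by (rule exI[of _ i], rule exI[of _ "Suc i"]) auto
  moreover have "\<Union>(prefix_partition n k) = {..k} \<union> {i. k < i \<and> i < n}"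
    using False by (auto simp: prefix_partition_def)
  moreover have "{..k} \<union> {i. k < i \<and> i < n} = {..<n}" using assms False by auto
  ultimately show ?thesis using assms False
    unfolding interval_partition_def prefix_partition_def by auto
qed (simp add: interval_partition_def prefix_partition_def)

lemma prefix_partition_0: "prefix_partition n 0 = singleton_partition n"
  unfolding prefix_partition_def singleton_partition_def by auto

lemma prefix_partition_whole: "prefix_partition n (n - 1) = whole_partition n"
  unfolding prefix_partition_def whole_partition_def by auto

lemma prefix_partition_step:
  assumes "k < n - 1"
  shows "merge_step (prefix_partition n k) (prefix_partition n (Suc k))"
proof -
  let ?A = "{..k}" and ?B = "{Suc k}"
  have "?A \<in> prefix_partition n k" "?B \<in> prefix_partition n k"
    using assms by (auto simp: prefix_partition_def)
  moreover have ne: "?A \<noteq> ?B" by (metis atMost_iff le0 nat.distinct(1) singletonD)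
  moreover have un: "?A \<union> ?B = {..Suc k}" by auto
  moreover have "is_interval {..Suc k}" unfolding is_interval_def
    by (rule exI[of _ 0], rule exI[of _ "Suc (Suc k)"]) auto
  moreover have "prefix_partition n (Suc k) = insert (?A \<union> ?B) (prefix_partition n k - {?A, ?B})"
  proof -
    have "{i} \<noteq> {..k}" if "k < i" for i using that by (metis atMost_iff insertI1 leD)
    then show ?thesis unfolding un prefix_partition_def using assms ne by (auto simp: Suc_lessI)
  qed
  ultimately show ?thesis unfolding merge_step_def by metis
qed

text \<open>Without a witness, the \<open>LEAST\<close> in the definition of \<open>twin_width\<close> would carry no information.\<close>

lemma ex_twin_ordered: "\<exists>d. twin_ordered n M d"
proof -
  \<comment> \<open>All row merges come before all column merges: \<open>min\<close> freezes the
    rows after \<open>n - 1\<close> steps, and truncated subtraction keeps the columns at singletons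
    until then.\<close>
  define Rs where "Rs t = prefix_partition n (min t (n - 1))" for t
  define Cs where "Cs t = prefix_partition n (t - (n - 1))" for t
  have part: "interval_partition n (Rs t)" "interval_partition n (Cs t)" if "t \<le> 2 * (n - 1)" for t
    using that by (auto simp: Rs_def Cs_def intro!: prefix_partition_interval)
  have ms: "merge_sequence n Rs Cs"
    unfolding merge_sequence_def
  proof (intro conjI allI impI)
    fix t assume t: "t < 2 * (n - 1)"
    show "merge_step (Rs t) (Rs (Suc t)) \<and> Cs (Suc t) = Cs t \<or>
         merge_step (Cs t) (Cs (Suc t)) \<and> Rs (Suc t) = Rs t"
    proof (cases "t < n - 1")
      case True
      then show ?thesis using prefix_partition_step[of t n] by (simp add: Rs_def Cs_def)
    next
      case False
      then show ?thesis using t prefix_partition_step[of "t - (n - 1)" n]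
        by (simp add: Rs_def Cs_def Suc_diff_le)
    qed
  qed (use part in \<open>simp_all add: Rs_def Cs_def prefix_partition_0
        prefix_partition_whole[symmetric]\<close>)
  \<comment> \<open>Any width will do, so counting all subsets of \<open>{..<n}\<close> is
    enough.\<close>
  have le: "card {A\<in>P. S A} \<le> (2::nat) ^ n" if "interval_partition n P" for P S
  proof -
    have "{A\<in>P. S A} \<subseteq> Pow {..<n}" using that by (auto simp: interval_partition_def)
    then show ?thesis by (metis card_Pow card_lessThan card_mono finite_Pow_iff finite_lessThan)
  qed
  have "wide_sequence M n (2 ^ n) Rs Cs"
    unfolding wide_sequence_def using le[OF part(1)] le[OF part(2)] by simp
  then show ?thesis using ms by (auto simp: twin_ordered_def)
qed

text \<open>The minimum in \<open>twin_width\<close> is attained by some pair of permutations, and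
  the bound for the permuted matrix carries back to \<open>M\<close> itself. This is why the
  algorithm never has to find those permutations.\<close>

theorem card_patterns_twin_width:
  assumes Q: "Q \<subseteq> {..<n}"
  shows "card (patterns n M Q) \<le> twin_width n M * 2 ^ twin_width n M * card Q + 2"
proof -
  define ok where "ok d \<longleftrightarrow> (\<exists>\<sigma> \<tau>. bij_betw \<sigma> {..<n} {..<n} \<and> bij_betw \<tau> {..<n} {..<n} \<and>
      twin_ordered n (\<lambda>i j. M (\<sigma> i) (\<tau> j)) d)" for d
  have "\<exists>d. ok d" unfolding ok_def using ex_twin_ordered bij_betw_id by blast
  then have "ok (twin_width n M)" unfolding twin_width_def ok_def by (rule LeastI_ex)
  then obtain \<sigma> \<tau> where st: "bij_betw \<sigma> {..<n} {..<n}" "bij_betw \<tau> {..<n} {..<n}"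
    "twin_ordered n (\<lambda>i j. M (\<sigma> i) (\<tau> j)) (twin_width n M)" by (auto simp: ok_def)
  obtain Q' where "Q' \<subseteq> {..<n}" "card Q' = card Q"
    "card (patterns n M Q) \<le> card (patterns n (\<lambda>i j. M (\<sigma> i) (\<tau> j)) Q')"
    using card_patterns_permute[OF st(1,2) Q] .
  then show ?thesis using card_patterns_twin_ordered[OF st(3), of Q'] by simp
qed

section \<open>The tree of columns\<close>

text \<open>Heap-ordered tree with leaves \<open>n, \<dots>, 2n - 1\<close> for the columns and root \<open>1\<close>, for arbitrary \<open>n\<close>.
  The set of columns below a node need not be an interval.\<close>

definition leaves :: "nat \<Rightarrow> nat \<Rightarrow> nat set" where
  "leaves n x = {j. j < n \<and> (\<exists>e. (n + j) div 2 ^ e = x)}"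

lemma leaves_subset: "leaves n x \<subseteq> {..<n}"
  by (auto simp: leaves_def)

lemma leaves_leaf:
  assumes "n \<le> x" "x < 2 * n"
  shows "leaves n x = {x - n}"
proof -
  have "e = 0" if "j < n" "(n + j) div 2 ^ e = x" for j e
  proof (rule ccontr)
    assume "e \<noteq> 0"
    then have "(n + j) div 2 ^ e \<le> (n + j) div 2 ^ 1"
      by (intro div_le_mono2 power_increasing) auto
    then show False using that assms by auto
  qed
  then have "leaves n x \<subseteq> {x - n}" by (fastforce simp: leaves_def)
  moreover have "x - n \<in> leaves n x"
    using assms by (auto simp: leaves_def intro!: exI[of _ 0])
  ultimately show ?thesis by auto
qed

text \<open>The ancestors of leaf \<open>n + j\<close> are the quotients
  \<open>(n + j) div 2 ^ e\<close>. As \<open>x < n \<le> n + j\<close>, reaching \<open>x\<close>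
  takes at least one halving, and the value just before the last halving is one of the two
  children.\<close>

lemma leaves_node:
  assumes "0 < x" "x < n"
  shows "leaves n x = leaves n (2 * x) \<union> leaves n (2 * x + 1)"
proof -
  have "(\<exists>e. (n + j) div 2 ^ e = x) \<longleftrightarrow>
      (\<exists>e. (n + j) div 2 ^ e = 2 * x) \<or> (\<exists>e. (n + j) div 2 ^ e = 2 * x + 1)" (is "?l \<longleftrightarrow> ?r") for j
  proof
    assume ?l
    then obtain e where e: "(n + j) div 2 ^ e = x" by blast
    then obtain e' where "e = Suc e'" using assms by (cases e) auto
    then have "(n + j) div 2 ^ e' div 2 = x" using e by (metis div_mult2_eq power_Suc2)
    then have "(n + j) div 2 ^ e' = 2 * x \<or> (n + j) div 2 ^ e' = 2 * x + 1" by linarith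
    then show ?r by blast
  next
    assume ?r
    then obtain e where "(n + j) div 2 ^ e = 2 * x \<or> (n + j) div 2 ^ e = 2 * x + 1" by blast
    then have "(n + j) div 2 ^ e div 2 = x" by auto
    then have "(n + j) div 2 ^ Suc e = x" by (metis div_mult2_eq power_Suc2)
    then show ?l by blast
  qed
  then show ?thesis by (auto simp: leaves_def)
qed

text \<open>Going up from a leaf, a later ancestor is at most half of an earlier one, so
  \<open>2 * x\<close> and \<open>2 * x + 1\<close> cannot occur at different heights; at equal
  heights they would coincide. Disjointness is what makes the sum of the two children's 0-1 vectors
  a 0-1 vector again.\<close>

lemma leaves_siblings_disjoint:
  assumes "0 < x"
  shows "leaves n (2 * x) \<inter> leaves n (2 * x + 1) = {}"
proof -
  have le: "m div 2 ^ e' \<le> m div 2 ^ e div 2" if "e < e'" for m e e' :: nat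
  proof -
    have "m div 2 ^ e' \<le> m div 2 ^ Suc e"
      using that by (intro div_le_mono2 power_increasing) auto
    then show ?thesis by (metis div_mult2_eq power_Suc2)
  qed
  have False if a: "m div 2 ^ e = 2 * x" and b: "m div 2 ^ e' = 2 * x + 1" for m e e' :: nat
  proof (cases e e' rule: linorder_cases)
    case less then show ?thesis using le[OF less, of m] unfolding a b by simp
  next
    case equal then show ?thesis using a b by simp
  next
    case greater then show ?thesis using le[OF greater, of m] assms unfolding a b by simp
  qed
  then show ?thesis by (auto simp: leaves_def)
qed

lemma leaves_root:
  assumes "0 < n"
  shows "leaves n 1 = {..<n}"
proof -
  have "\<exists>e. m div 2 ^ e = 1" if "0 < m" for m :: nat
    using that
  proof (induction m rule: less_induct)
    case (less m)
    show ?case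
    proof (cases "m = 1")
      case False
      then obtain e where "m div 2 div 2 ^ e = 1" using less.IH[of "m div 2"] less.prems by auto
      then have "m div 2 ^ Suc e = 1" by (simp add: div_mult2_eq)
      then show ?thesis by blast
    qed (auto intro: exI[of _ 0])
  qed
  then show ?thesis using assms by (auto simp: leaves_def)
qed

text \<open>Double counting: a pair of a node \<open>x\<close> and a column \<open>j\<close> below
  it is determined by \<open>j\<close> and the height \<open>e\<close>, and \<open>x \<ge> 1\<close>
  forces \<open>2 ^ e \<le> n + j \<le> 2 * n\<close>. Each column is thus counted at most once per
  possible height.\<close>

lemma sum_card_leaves:
  "real (\<Sum>x\<in>{1..<n}. card (leaves n x)) \<le> real n * (2 * ln (real (n + 2)) / ln 2 + 1)"
proof -
  define E where "E = {e::nat. 2 ^ e \<le> 2 * n}"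
  have Esub: "E \<subseteq> {..2 * n}"
  proof
    fix e assume "e \<in> E"
    then have "2 ^ e \<le> 2 * n" by (simp add: E_def)
    moreover have "e < 2 ^ e" by (rule less_exp)
    ultimately have "e \<le> 2 * n" by linarith
    then show "e \<in> {..2 * n}" by simp
  qed
  then have finE: "finite E" by (rule finite_subset) simp
  have "(\<Sum>x\<in>{1..<n}. card (leaves n x)) = card (SIGMA x:{1..<n}. leaves n x)"
    using leaves_subset by (subst card_SigmaI) (auto intro: finite_subset)
  also have "\<dots> \<le> card ((\<lambda>(j, e). ((n + j) div 2 ^ e, j)) ` ({..<n} \<times> E))"
  proof (rule card_mono)
    show "finite ((\<lambda>(j, e). ((n + j) div 2 ^ e, j)) ` ({..<n} \<times> E))" using finE by simp
    show "(SIGMA x:{1..<n}. leaves n x) \<subseteq> (\<lambda>(j, e). ((n + j) div 2 ^ e, j)) ` ({..<n} \<times> E)"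
    proof (rule subsetI, clarify)
      fix x j assume x: "x \<in> {1..<n}" "j \<in> leaves n x"
      then obtain e where e: "j < n" "(n + j) div 2 ^ e = x" by (auto simp: leaves_def)
      have "2 ^ e \<le> n + j" using e x by (metis atLeastLessThan_iff div_less not_le not_one_le_zero)
      then have "e \<in> E" using e by (simp add: E_def)
      then show "(x, j) \<in> (\<lambda>(j, e). ((n + j) div 2 ^ e, j)) ` ({..<n} \<times> E)"
        using e by force
    qed
  qed
  also have "\<dots> \<le> card ({..<n} \<times> E)" using finE by (intro card_image_le) simp
  also have "\<dots> = n * card E" by (simp add: card_cartesian_product)
  finally have 1: "(\<Sum>x\<in>{1..<n}. card (leaves n x)) \<le> n * card E" .
  have 2: "real (card E) \<le> 2 * ln (real (n + 2)) / ln 2 + 1"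
  proof (cases "E = {}")
    case False
    define m where "m = Max E"
    have "m \<in> E" unfolding m_def using finE False by (rule Max_in)
    then have "(2::real) ^ m \<le> real (2 * n)"
      unfolding E_def by (metis mem_Collect_eq of_nat_le_iff of_nat_numeral of_nat_power)
    \<comment> \<open>The crude \<open>2 * n \<le> (n + 2) ^ 2\<close> produces the factor 2 before
      the logarithm; \<open>n + 2\<close> keeps that logarithm positive for every
      \<open>n\<close>.\<close>
    also have "\<dots> \<le> real (n + 2) ^ 2" by (simp add: power2_eq_square algebra_simps)
    finally have "ln ((2::real) ^ m) \<le> ln (real (n + 2) ^ 2)" by (subst ln_le_cancel_iff) auto
    then have "real m * ln 2 \<le> 2 * ln (real (n + 2))" by (simp add: ln_realpow)
    then have "real m \<le> 2 * ln (real (n + 2)) / ln 2" by (simp add: field_simps)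
    moreover have "E \<subseteq> {..m}" using finE by (auto simp: m_def)
    then have "card E \<le> Suc m" using card_mono[of "{..m}" E] by simp
    ultimately show ?thesis by simp
  qed simp
  have "real (\<Sum>x\<in>{1..<n}. card (leaves n x)) \<le> real (n * card E)" using 1 by (rule of_nat_mono)
  also have "\<dots> \<le> real n * (2 * ln (real (n + 2)) / ln 2 + 1)"
    unfolding of_nat_mult using 2 by (intro mult_left_mono) auto
  finally show ?thesis .
qed

text \<open>Nodes of the shared trees: \<open>g i x\<close> is the name of the subtree at heap position \<open>x\<close> in the
  tree of row \<open>i\<close>, a function \<open>D\<close> of the names of its two children.\<close>

lemma node_determined_by_pattern:
  assumes leaf: "\<And>i x. i < n \<Longrightarrow> n \<le> x \<Longrightarrow> x < 2 * n \<Longrightarrow> g i x = h x (M i (x - n))"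
    and node: "\<And>i x. i < n \<Longrightarrow> 0 < x \<Longrightarrow> x < n \<Longrightarrow> g i x = D (g i (2 * x)) (g i (2 * x + 1))"
    and "i < n" "i' < n" "0 < x" "x < 2 * n"
    and "\<And>j. j \<in> leaves n x \<Longrightarrow> M i j = M i' j"
  shows "g i x = g i' x"
  using assms(5-7)
proof (induction "2 * n - x" arbitrary: x rule: less_induct)
  case less
  show ?case
  proof (cases "n \<le> x")
    case True
    then have "leaves n x = {x - n}" using less.prems by (intro leaves_leaf)
    then show ?thesis using less.prems True leaf assms(3,4) by simp
  next
    case False
    then have l: "leaves n x = leaves n (2 * x) \<union> leaves n (2 * x + 1)"
      using less.prems by (intro leaves_node) auto
    have "g i (2 * x) = g i' (2 * x)" using less.prems False l by (intro less.hyps) auto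
    moreover have "g i (2 * x + 1) = g i' (2 * x + 1)"
      using less.prems False l by (intro less.hyps) auto
    ultimately show ?thesis
      using node[OF assms(3)] node[OF assms(4)] less.prems(1) False by simp
  qed
qed

text \<open>At a fixed position the name is a function of the row's pattern on the columns below, so
  there are no more names than patterns. The pattern bound is then summed over the internal
  positions.\<close>

lemma card_nodes_le:
  assumes leaf: "\<And>i x. i < n \<Longrightarrow> n \<le> x \<Longrightarrow> x < 2 * n \<Longrightarrow> g i x = h x (M i (x - n))"
    and node: "\<And>i x. i < n \<Longrightarrow> 0 < x \<Longrightarrow> x < n \<Longrightarrow> g i x = D (g i (2 * x)) (g i (2 * x + 1))"
    and d: "twin_width n M = d"
  shows "real (card ((\<lambda>(i, x). g i x) ` ({..<n} \<times> {1..<n})))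
    \<le> real n * (real (d * 2 ^ d) * (2 * ln (real (n + 2)) / ln 2 + 1) + 2)"
proof -
  have level: "card ((\<lambda>i. g i x) ` {..<n}) \<le> d * 2 ^ d * card (leaves n x) + 2"
    if x: "x \<in> {1..<n}" for x
  proof -
    \<comment> \<open>The witness sends a pattern to the name received by a chosen row with this
      pattern.\<close>
    have "\<exists>f. \<forall>i<n. g i x = f {j\<in>leaves n x. M i j}"
    proof (intro exI allI impI)
      fix i assume i: "i < n"
      define i' where "i' = (SOME i'. i' < n \<and> {j\<in>leaves n x. M i' j} = {j\<in>leaves n x. M i j})"
      have "i' < n \<and> {j\<in>leaves n x. M i' j} = {j\<in>leaves n x. M i j}"
        unfolding i'_def by (rule someI[of _ i]) (simp add: i)
      then show "g i x = (\<lambda>S. g (SOME i'. i' < n \<and> {j\<in>leaves n x. M i' j} = S) x) {j\<in>leaves n x. M i j}"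
        using node_determined_by_pattern[of n g h M D i i' x, OF leaf node i] x
        unfolding i'_def[symmetric] by (auto simp: set_eq_iff)
    qed
    then obtain f where f: "\<And>i. i < n \<Longrightarrow> g i x = f {j\<in>leaves n x. M i j}" by blast
    have "(\<lambda>i. g i x) ` {..<n} = f ` patterns n M (leaves n x)"
      unfolding patterns_def image_image by (rule image_cong) (auto simp: f)
    then have "card ((\<lambda>i. g i x) ` {..<n}) \<le> card (patterns n M (leaves n x))"
      by (simp add: card_image_le)
    also have "\<dots> \<le> d * 2 ^ d * card (leaves n x) + 2"
      using card_patterns_twin_width[OF leaves_subset] d by blast
    finally show ?thesis .
  qed
  have "(\<lambda>(i, x). g i x) ` ({..<n} \<times> {1..<n}) = (\<Union>x\<in>{1..<n}. (\<lambda>i. g i x) ` {..<n})" by auto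
  then have "card ((\<lambda>(i, x). g i x) ` ({..<n} \<times> {1..<n})) \<le> (\<Sum>x\<in>{1..<n}. card ((\<lambda>i. g i x) ` {..<n}))"
    by (simp add: card_UN_le)
  also have "\<dots> \<le> (\<Sum>x\<in>{1..<n}. d * 2 ^ d * card (leaves n x) + 2)"
    using level by (intro sum_mono) auto
  also have "\<dots> \<le> d * 2 ^ d * (\<Sum>x\<in>{1..<n}. card (leaves n x)) + 2 * n"
    unfolding sum.distrib sum_distrib_left by simp
  finally have "real (card ((\<lambda>(i, x). g i x) ` ({..<n} \<times> {1..<n})))
      \<le> real (d * 2 ^ d * (\<Sum>x\<in>{1..<n}. card (leaves n x)) + 2 * n)" by (rule of_nat_mono)
  also have "\<dots> = real (d * 2 ^ d) * real (\<Sum>x\<in>{1..<n}. card (leaves n x)) + 2 * real n" by simp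
  also have "\<dots> \<le> real (d * 2 ^ d) * (real n * (2 * ln (real (n + 2)) / ln 2 + 1)) + 2 * real n"
    by (intro add_right_mono mult_left_mono sum_card_leaves) auto
  finally show ?thesis by (simp only: algebra_simps)
qed

section \<open>Timed reachability\<close>

definition bnd :: "int \<Rightarrow> (int \<Rightarrow> int) \<Rightarrow> bool" where
  "bnd B I \<longleftrightarrow> (\<forall>x. \<bar>I x\<bar> \<le> B)"

lemma bnd_upd [simp]: "bnd B I \<Longrightarrow> bnd B (I(a := v)) \<longleftrightarrow> \<bar>v\<bar> \<le> B"
  by (auto simp: bnd_def)

text \<open>No halting is asked for, so that pieces of code can be composed; \<open>B\<close> is
  required at every intermediate state because \<open>runs_within\<close> bounds the registers along
  the whole run.\<close>

definition reaches ::
  "instr list \<Rightarrow> int \<Rightarrow> nat \<Rightarrow> state \<Rightarrow> (state \<Rightarrow> bool) \<Rightarrow> bool" where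
  "reaches P B T s \<Phi> \<longleftrightarrow>
     (\<exists>t\<le>T. \<Phi> (run P t s) \<and> (\<forall>t'\<le>t. bnd B (fst (snd (run P t' s)))))"

text \<open>Recursion on an exact step count lets the simplifier execute straight-line code
  symbolically; \<open>reaches\<close> then relaxes the count to an upper bound.\<close>

primrec after ::
  "instr list \<Rightarrow> int \<Rightarrow> nat \<Rightarrow> (state \<Rightarrow> bool) \<Rightarrow> state \<Rightarrow> bool" where
  "after P B 0 \<Phi> s \<longleftrightarrow> bnd B (fst (snd s)) \<and> \<Phi> s"
| "after P B (Suc k) \<Phi> s \<longleftrightarrow> bnd B (fst (snd s)) \<and> after P B k \<Phi> (step P s)"

lemma run_Suc: "run P (Suc t) s = run P t (step P s)"
  unfolding run_def by (simp add: funpow_swap1)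

lemma run_add: "run P (t + t') s = run P t' (run P t s)"
  unfolding run_def by (metis add.commute comp_apply funpow_add)

lemma after_run:
  "after P B k \<Phi> s \<longleftrightarrow> \<Phi> (run P k s) \<and> (\<forall>t\<le>k. bnd B (fst (snd (run P t s))))"
proof (induction k arbitrary: s)
  case 0 then show ?case by (auto simp: run_def)
next
  case (Suc k)
  have "(\<forall>t\<le>Suc k. bnd B (fst (snd (run P t s)))) \<longleftrightarrow>
      bnd B (fst (snd (run P 0 s))) \<and> (\<forall>t\<le>k. bnd B (fst (snd (run P (Suc t) s))))"
    by (metis Suc_le_mono not0_implies_Suc zero_le)
  then show ?case using Suc[of "step P s"] by (auto simp: run_Suc) (auto simp: run_def)
qed

lemma after_step:
  "after P B (Suc k) \<Phi> (pc, I, R) \<longleftrightarrow> bnd B I \<and>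
     after P B k \<Phi> (if pc \<ge> length P \<or> P ! pc = HALT then (pc, I, R) else exec (P ! pc) (pc, I, R))"
  by (simp add: step_def halted_def)

lemma after_step_numeral:
  "after P B (numeral k) \<Phi> (pc, I, R) \<longleftrightarrow> bnd B I \<and>
     after P B (pred_numeral k) \<Phi>
       (if pc \<ge> length P \<or> P ! pc = HALT then (pc, I, R) else exec (P ! pc) (pc, I, R))"
  unfolding numeral_eq_Suc by (rule after_step)

lemma reaches_after: "after P B k \<Phi> s \<Longrightarrow> k \<le> T \<Longrightarrow> reaches P B T s \<Phi>"
  by (auto simp: reaches_def after_run)

lemma reaches_trans:
  assumes "reaches P B T1 s \<Psi>" "\<And>s'. \<Psi> s' \<Longrightarrow> reaches P B T2 s' \<Phi>" "T1 + T2 \<le> T"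
  shows "reaches P B T s \<Phi>"
proof -
  obtain t1 where t1: "t1 \<le> T1" "\<Psi> (run P t1 s)" "\<And>t'. t' \<le> t1 \<Longrightarrow> bnd B (fst (snd (run P t' s)))"
    using assms(1) by (auto simp: reaches_def)
  obtain t2 where t2: "t2 \<le> T2" "\<Phi> (run P t2 (run P t1 s))"
    "\<And>t'. t' \<le> t2 \<Longrightarrow> bnd B (fst (snd (run P t' (run P t1 s))))"
    using assms(2)[OF t1(2)] by (auto simp: reaches_def)
  have "bnd B (fst (snd (run P t' s)))" if "t' \<le> t1 + t2" for t'
  proof (cases "t' \<le> t1")
    case False
    then have "run P t' s = run P (t' - t1) (run P t1 s)" by (simp flip: run_add)
    then show ?thesis using t2(3)[of "t' - t1"] that by simp
  qed (rule t1(3))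
  then show ?thesis unfolding reaches_def using t1 t2 assms(3)
    by (intro exI[of _ "t1 + t2"]) (auto simp: run_add)
qed

lemma reaches_mono:
  "reaches P B T s \<Psi> \<Longrightarrow> (\<And>s'. \<Psi> s' \<Longrightarrow> \<Phi> s') \<Longrightarrow> T \<le> T' \<Longrightarrow> reaches P B T' s \<Phi>"
  unfolding reaches_def by (meson le_trans)

text \<open>The last premise serves the case of zero iterations: \<open>reaches\<close> constrains
  the registers of the starting state even when no step is taken.\<close>

lemma reaches_loop:
  assumes "\<And>k s. k < m \<Longrightarrow> Inv k s \<Longrightarrow> reaches P B c s (Inv (Suc k))"
    and "Inv 0 s" and "bnd B (fst (snd s))"
  shows "reaches P B (c * m) s (Inv m)"
  using assms(1)
proof (induction m)
  case 0 then show ?case using assms(2,3) by (auto simp: reaches_def run_def)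
next
  case (Suc m)
  show ?case
    by (rule reaches_trans[where \<Psi> = "Inv m"]) (use Suc in auto)
qed

section \<open>Preprocessing\<close>

text \<open>Integer memory, with \<open>w = n\<^sup>2 + 1\<close>, which exceeds every node name:
  \<open>-100 - x\<close> holds the name at heap position \<open>x\<close> for the current row, \<open>-100 - w - p\<close> and \<open>-100 - 2w - p\<close>
  the children of node \<open>p\<close>, \<open>-100 - 3w - i\<close> the root of row \<open>i\<close>, and \<open>w (a + 1) + b\<close> the name of the
  node with children \<open>a\<close>, \<open>b\<close> (0 if there is none yet).
  Name \<open>0\<close> is the zero vector and name \<open>j + 1\<close>, for \<open>j < n\<close>, the unit vector of column \<open>j\<close>.
  Scalars: \<open>-1\<close> is \<open>1\<close>, \<open>-2\<close> is \<open>0\<close>, \<open>-3\<close> is \<open>w\<close>, \<open>-4, \<dots>, -7\<close> are the array bases, \<open>-8\<close> is the largest name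
  in use, \<open>-9\<close> the row, \<open>-10\<close> the column or heap position, \<open>-16\<close> the input address.\<close>

definition preprocess :: "instr list" where
  "preprocess = [
    ICONST (-1) 1, IMUL (-3) 0 0, IADD (-3) (-3) (-1), ICONST (-4) (-100), ISUB (-5) (-4) (-3),
    ISUB (-6) (-5) (-3), ISUB (-7) (-6) (-3), IADD (-8) 0 (-2), ICONST (-16) 1,
    JLT (-9) 0 11, JZ (-2) 54,
    ICONST (-10) 0,
    JLT (-10) 0 14, JZ (-2) 23,
    ILOAD (-11) (-16), IADD (-12) (-10) (-1), IMUL (-11) (-11) (-12), IADD (-12) (-10) 0,
    ISUB (-12) (-4) (-12), ISTORE (-12) (-11), IADD (-10) (-10) (-1), IADD (-16) (-16) (-1),
    JZ (-2) 12,
    ISUB (-10) 0 (-1),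
    JLT (-2) (-10) 26, JZ (-2) 48,
    IADD (-11) (-10) (-10), ISUB (-11) (-4) (-11), ILOAD (-12) (-11), ISUB (-11) (-11) (-1),
    ILOAD (-13) (-11), IADD (-14) (-12) (-1), IMUL (-14) (-3) (-14), IADD (-14) (-14) (-13),
    ILOAD (-15) (-14), JZ (-15) 37, JZ (-2) 44,
    IADD (-8) (-8) (-1), IADD (-15) (-8) (-2), ISTORE (-14) (-8),
    ISUB (-11) (-5) (-8), ISTORE (-11) (-12), ISUB (-11) (-6) (-8), ISTORE (-11) (-13),
    ISUB (-11) (-4) (-10), ISTORE (-11) (-15), ISUB (-10) (-10) (-1), JZ (-2) 24,
    ISUB (-11) (-4) (-1), ILOAD (-12) (-11), ISUB (-11) (-7) (-9), ISTORE (-11) (-12),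
    IADD (-9) (-9) (-1), JZ (-2) 9,
    HALT]"

section \<open>Symbolic execution of the preprocessing loop bodies\<close>

lemma preprocess_leaf_step:
  assumes "bnd B I" "I 0 = int n" "I (-1) = 1" "I (-2) = 0" "I (-4) = -100"
    "I (-10) = int j" "j < n" "I (-16) = q" "0 < q" "I q = b" "b = 0 \<or> b = 1"
    "100 + 2 * int n \<le> B" "q < B"
  shows "after preprocess B 10 (\<lambda>(pc, I', R'). pc = 12 \<and> R' = R \<and> bnd B I' \<and> I' (-10) = int (Suc j) \<and>
     I' (-16) = q + 1 \<and> I' (-100 - int (n + j)) = b * int (Suc j) \<and>
     (\<forall>y. y \<notin> {-10, -11, -12, -16, -100 - int (n + j)} \<longrightarrow> I' y = I y)) (12, I, R)"
  using assms
  by (auto simp: after_step_numeral after_step preprocess_def simp del: after.simps(2))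

text \<open>Names are bounded without reference to \<open>d\<close>: there are \<open>n\<close> unit
  vectors and at most one new name for each of the \<open>n * (n - 1)\<close> pairs of a row and an
  internal position, so no name exceeds \<open>n * n\<close>.\<close>

definition wd :: "nat \<Rightarrow> int" where
  "wd n = int n * int n + 1"

text \<open>The first bound keeps the heap cells \<open>-100 - x\<close>, \<open>x < 2 * n\<close>,
  clear of the child tables, which lie below \<open>-100 - w\<close>.\<close>

lemma wd_ge: "2 * int n \<le> wd n" "1 \<le> wd n"
proof -
  have "0 \<le> (int n - 1) * (int n - 1)" by simp
  then show "2 * int n \<le> wd n" by (simp add: wd_def algebra_simps)
qed (simp add: wd_def)

text \<open>A key has last digit \<open>b\<close> in base \<open>w\<close> and quotient
  \<open>a + 1\<close>, so direct addressing has no collisions.\<close>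

lemma wd_key_inj:
  assumes "w * (a + 1) + b = w * (a' + 1) + b'" "0 \<le> b" "b < w" "0 \<le> b'" "b' < (w::int)"
  shows "a = a' \<and> b = b'"
proof -
  have "(w * (c + 1) + e) div w = c + 1" if "0 \<le> e" "e < w" for c e
    using that by auto
  from this[of b a] this[of b' a'] have "a + 1 = a' + 1" unfolding assms(1) using assms by metis
  then have "a = a'" by simp
  then show ?thesis using assms(1) by simp
qed

text \<open>The shift from \<open>a\<close> to \<open>a + 1\<close> pushes every key to at least
  \<open>w\<close>, beyond the input matrix, whose last cell is \<open>n * n = w - 1\<close>. The
  upper bound enters the word size.\<close>

lemma wd_key_bounds:
  assumes "0 \<le> a" "a < w" "0 \<le> b" "b < (w::int)"
  shows "w \<le> w * (a + 1)" "w * (a + 1) \<le> w * w"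
proof -
  show "w \<le> w * (a + 1)" using assms by (simp add: algebra_simps)
  show "w * (a + 1) \<le> w * w" using assms by (intro mult_left_mono) auto
qed

definition scalars :: "nat \<Rightarrow> int \<Rightarrow> (int \<Rightarrow> int) \<Rightarrow> bool" where
  "scalars n N I \<longleftrightarrow> I 0 = int n \<and> I (-1) = 1 \<and> I (-2) = 0 \<and> I (-3) = wd n \<and> I (-4) = -100 \<and>
     I (-5) = -100 - wd n \<and> I (-6) = -100 - 2 * wd n \<and> I (-7) = -100 - 3 * wd n \<and> I (-8) = N"

text \<open>The table hit. Only the heap cell of \<open>x\<close> and scratch registers change, so
  the name tables stay valid as they are.\<close>

lemma preprocess_found_step:
  assumes "bnd B I" "scalars n N I" "I (-10) = int x" "0 < x" "x < n"
    "I (-100 - 2 * int x) = a" "I (-101 - 2 * int x) = b" "0 \<le> a" "a < wd n" "0 \<le> b" "b < wd n"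
    "I (wd n * (a + 1) + b) = r" "r \<noteq> 0" "wd n * wd n + wd n + 100 \<le> B"
  shows "after preprocess B 16 (\<lambda>(pc, I', R'). pc = 24 \<and> R' = R \<and> bnd B I' \<and> I' (-10) = int x - 1 \<and>
     I' (-100 - int x) = r \<and>
     (\<forall>y. y \<notin> {-10, -11, -12, -13, -14, -15, -100 - int x} \<longrightarrow> I' y = I y)) (24, I, R)"
proof -
  define w where "w = wd n"
  define K where "K = w * (a + 1)"
  have K: "w \<le> K" "K \<le> w * w" unfolding K_def w_def using wd_key_bounds assms by auto
  have w: "2 * int n \<le> w" "1 \<le> w" using wd_ge by (auto simp: w_def)
  have "\<bar>r\<bar> \<le> B" using assms(1,12) by (auto simp: bnd_def)
  note assms[unfolded scalars_def, folded w_def, folded K_def]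
  with \<open>\<bar>r\<bar> \<le> B\<close> K w show ?thesis
    by (auto simp: after_step_numeral after_step preprocess_def K_def[symmetric] simp del: after.simps(2))
qed

text \<open>The table miss is the longest path through the loop body; its 22 steps become the cost
  per internal position.\<close>

lemma preprocess_new_step:
  assumes "bnd B I" "scalars n N I" "I (-10) = int x" "0 < x" "x < n"
    "I (-100 - 2 * int x) = a" "I (-101 - 2 * int x) = b" "0 \<le> a" "a < wd n" "0 \<le> b" "b < wd n"
    "I (wd n * (a + 1) + b) = 0" "0 \<le> N" "N + 1 < wd n" "wd n * wd n + 3 * wd n + 100 \<le> B"
  shows "after preprocess B 22 (\<lambda>(pc, I', R'). pc = 24 \<and> R' = R \<and> bnd B I' \<and> I' (-10) = int x - 1 \<and>
     I' (-100 - int x) = N + 1 \<and> I' (-8) = N + 1 \<and> I' (wd n * (a + 1) + b) = N + 1 \<and>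
     I' (-100 - wd n - (N + 1)) = a \<and> I' (-100 - 2 * wd n - (N + 1)) = b \<and>
     (\<forall>y. y \<notin> {-8, -10, -11, -12, -13, -14, -15, -100 - int x, wd n * (a + 1) + b,
        -100 - wd n - (N + 1), -100 - 2 * wd n - (N + 1)} \<longrightarrow> I' y = I y)) (24, I, R)"
proof -
  define w where "w = wd n"
  define K where "K = w * (a + 1)"
  have K: "w \<le> K" "K \<le> w * w" unfolding K_def w_def using wd_key_bounds assms by auto
  have w: "2 * int n \<le> w" "1 \<le> w" using wd_ge by (auto simp: w_def)
  note assms[unfolded scalars_def, folded w_def, folded K_def]
  with K w show ?thesis unfolding w_def[symmetric] K_def[symmetric]
    by (auto simp: after_step_numeral after_step preprocess_def K_def[symmetric] simp del: after.simps(2))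
qed

lemma preprocess_root_step:
  assumes "bnd B I" "scalars n N I" "I (-10) = 0" "I (-9) = int i" "i < n"
    "I (-101) = r" "4 * wd n + 100 \<le> B"
  shows "after preprocess B 8 (\<lambda>(pc, I', R'). pc = 9 \<and> R' = R \<and> bnd B I' \<and> I' (-9) = int (Suc i) \<and>
     I' (-100 - 3 * wd n - int i) = r \<and>
     (\<forall>y. y \<notin> {-9, -11, -12, -100 - 3 * wd n - int i} \<longrightarrow> I' y = I y)) (24, I, R)"
proof -
  define w where "w = wd n"
  have w: "2 * int n \<le> w" "1 \<le> w" using wd_ge by (auto simp: w_def)
  have "\<bar>r\<bar> \<le> B" using assms(1,6) by (auto simp: bnd_def)
  note assms[unfolded scalars_def, folded w_def]
  with w \<open>\<bar>r\<bar> \<le> B\<close> show ?thesis unfolding w_def[symmetric]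
    by (auto simp: after_step_numeral after_step preprocess_def simp del: after.simps(2))
qed

text \<open>Ghost data: \<open>E\<close> is the set of (row, heap position) pairs processed so far, \<open>g\<close> gives the names assigned
  to them, and \<open>cf p\<close> is the row vector represented by the name \<open>p\<close>.\<close>

locale tables =
  fixes n :: nat and M :: "nat \<Rightarrow> nat \<Rightarrow> bool" and E :: "(nat \<times> nat) set"
    and g :: "nat \<Rightarrow> nat \<Rightarrow> int" and cf :: "int \<Rightarrow> nat \<Rightarrow> real" and N :: int and I :: "int \<Rightarrow> int"
  assumes dom: "E \<subseteq> {..<n} \<times> {1..<n}"
    and input: "\<And>k. k < n * n \<Longrightarrow> I (1 + int k) = (if M (k div n) (k mod n) then 1 else 0)"
    and count: "int n \<le> N"
    and used: "{int n<..N} \<subseteq> (\<lambda>(i, x). g i x) ` E"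
    and cf_zero: "\<And>j. cf 0 j = 0"
    and cf_leaf: "\<And>c j. c < n \<Longrightarrow> cf (int c + 1) j = of_bool (j = c)"
    and children: "\<And>p. int n < p \<Longrightarrow> p \<le> N \<Longrightarrow>
        0 \<le> I (-100 - wd n - p) \<and> I (-100 - wd n - p) < p \<and>
        0 \<le> I (-100 - 2 * wd n - p) \<and> I (-100 - 2 * wd n - p) < p \<and>
        (\<forall>j. cf p j = cf (I (-100 - wd n - p)) j + cf (I (-100 - 2 * wd n - p)) j)"
    and entry: "\<And>a b. 0 \<le> a \<Longrightarrow> a < wd n \<Longrightarrow> 0 \<le> b \<Longrightarrow> b < wd n \<Longrightarrow> I (wd n * (a + 1) + b) \<noteq> 0 \<Longrightarrow>
        a \<le> N \<and> b \<le> N \<and> int n < I (wd n * (a + 1) + b) \<and> I (wd n * (a + 1) + b) \<le> N \<and>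
        (\<forall>j. cf (I (wd n * (a + 1) + b)) j = cf a j + cf b j)"
    and found: "\<And>i x. (i, x) \<in> E \<Longrightarrow>
        g i x \<noteq> 0 \<and> I (wd n * (g i (2 * x) + 1) + g i (2 * x + 1)) = g i x"
    and range: "\<And>i x. 0 \<le> g i x \<and> g i x \<le> N"
    and cf_row: "\<And>i x j. (i, x) \<in> E \<or> n \<le> x \<and> x < 2 * n \<Longrightarrow>
        cf (g i x) j = of_bool (j \<in> leaves n x \<and> M i j)"
    and leaf: "\<And>i x. n \<le> x \<Longrightarrow> x < 2 * n \<Longrightarrow> g i x = (if M i (x - n) then int (x - n) + 1 else 0)"

section \<open>Preservation of the table invariant\<close>

lemmas tablesD = tables.dom tables.input tables.count tables.used tables.cf_zero tables.cf_leaf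
  tables.children tables.entry tables.found tables.range tables.cf_row tables.leaf

text \<open>By \<open>used\<close>, every name above \<open>n\<close> was given to some processed
  pair, so \<open>N - n\<close> is at most the number of such pairs. This bounds the address space
  for every matrix, whatever its twin-width.\<close>

lemma tables_card:
  assumes "tables n M E g cf N I"
  shows "N \<le> int n + int (card E)" "N < wd n"
proof -
  note t = tablesD[OF assms]
  have fin: "finite E" using t(1) by (rule finite_subset) simp
  have "card {int n<..N} \<le> card ((\<lambda>(i, x). g i x) ` E)" using t(4) fin by (intro card_mono) auto
  also have "\<dots> \<le> card E" using fin by (rule card_image_le)
  finally show 1: "N \<le> int n + int (card E)" by simp
  have "card E \<le> card ({..<n} \<times> {1..<n})" using t(1) by (intro card_mono) auto
  then have "n + card E \<le> n + n * (n - 1)" by (simp add: card_cartesian_product)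
  also have "\<dots> = n * n" by (cases n) auto
  finally have "int n + int (card E) \<le> int n * int n" by (metis of_nat_add of_nat_le_iff of_nat_mult)
  then show "N < wd n" using 1 by (simp add: wd_def)
qed

text \<open>\<open>tables\<close> reads the memory only at positive addresses (input and dictionary)
  and in the two child tables; scratch registers, heap cells and roots may be overwritten.\<close>

lemma tables_cong:
  assumes t: "tables n M E g cf N I"
    and eq: "\<And>y. 0 < y \<or> -100 - 3 * wd n < y \<and> y \<le> -100 - wd n \<Longrightarrow> I' y = I y"
  shows "tables n M E g cf N I'"
proof -
  note t' = tablesD[OF t] and N = tables_card(2)[OF t]
  have child: "I' (-100 - wd n - p) = I (-100 - wd n - p)"
    "I' (-100 - 2 * wd n - p) = I (-100 - 2 * wd n - p)" if "int n < p" "p \<le> N" for p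
    using that N by (intro eq; linarith)+
  have key: "I' (wd n * (a + 1) + b) = I (wd n * (a + 1) + b)"
    if "0 \<le> a" "a < wd n" "0 \<le> b" "b < wd n" for a b
    using wd_key_bounds[OF that] wd_ge[of n] that by (intro eq) linarith
  have inp: "I' (1 + int k) = I (1 + int k)" for k by (intro eq) auto
  have less: "g i x < wd n" for i x using t'(10)[of i x] N by simp
  show ?thesis
  proof (rule tables.intro)
    show "0 \<le> I' (- 100 - wd n - p) \<and> I' (- 100 - wd n - p) < p \<and>
         0 \<le> I' (- 100 - 2 * wd n - p) \<and> I' (- 100 - 2 * wd n - p) < p \<and>
         (\<forall>j. cf p j = cf (I' (- 100 - wd n - p)) j + cf (I' (- 100 - 2 * wd n - p)) j)"
      if "int n < p" "p \<le> N" for p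
      using t'(7)[OF that] unfolding child[OF that] .
    show "a \<le> N \<and> b \<le> N \<and> int n < I' (wd n * (a + 1) + b) \<and> I' (wd n * (a + 1) + b) \<le> N \<and>
        (\<forall>j. cf (I' (wd n * (a + 1) + b)) j = cf a j + cf b j)"
      if "0 \<le> a" "a < wd n" "0 \<le> b" "b < wd n" "I' (wd n * (a + 1) + b) \<noteq> 0" for a b
      using t'(8)[OF that(1-4)] that(5) unfolding key[OF that(1-4)] by blast
    show "g i x \<noteq> 0 \<and> I' (wd n * (g i (2 * x) + 1) + g i (2 * x + 1)) = g i x"
      if "(i, x) \<in> E" for i x
      using t'(9)[OF that] key less t'(10) by simp
  qed (use t'(1-6,10-12) inp in auto)
qed

text \<open>Heap positions are processed downwards, so both children of \<open>x\<close> are leaves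
  or already named in row \<open>i\<close>, and \<open>x\<close> is not a child of any processed
  position of that row. Hence redefining \<open>g i x\<close> disturbs no earlier entry.\<close>

lemma tables_found:
  assumes t: "tables n M E g cf N I"
    and i: "i < n" "0 < x" "x < n" "\<And>x'. (i, x') \<in> E \<longleftrightarrow> x < x' \<and> x' < n"
    and r: "I (wd n * (g i (2 * x) + 1) + g i (2 * x + 1)) = r" "r \<noteq> 0"
  shows "tables n M (insert (i, x) E) (g(i := (g i)(x := r))) cf N I"
proof -
  note t' = tablesD[OF t] and N = tables_card(2)[OF t]
  have ne: "(i', x') \<in> E \<Longrightarrow> i' \<noteq> i \<or> 2 * x' \<noteq> x \<and> 2 * x' + 1 \<noteq> x \<and> x' \<noteq> x" for i' x'
    using i(4)[of x'] by auto
  have g: "0 \<le> g i y" "g i y < wd n" for y using t'(10)[of i y] N by auto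
  have d: "int n < r" "r \<le> N" "\<And>j. cf r j = cf (g i (2 * x)) j + cf (g i (2 * x + 1)) j"
    using t'(8)[of "g i (2 * x)" "g i (2 * x + 1)"] g r by auto
  have "(i, 2 * x) \<in> E \<or> n \<le> 2 * x \<and> 2 * x < 2 * n"
    "(i, 2 * x + 1) \<in> E \<or> n \<le> 2 * x + 1 \<and> 2 * x + 1 < 2 * n" using i(1-3) i(4)[of "2 * x"] i(4)[of "2 * x + 1"] by auto
  then have c: "cf r j = of_bool (j \<in> leaves n x \<and> M i j)" for j
    unfolding d(3) using t'(11) leaves_node[OF i(2,3)] leaves_siblings_disjoint[OF i(2), of n]
    by auto
  show ?thesis
  proof (rule tables.intro)
    show "{int n<..N} \<subseteq> (\<lambda>(i', x'). (g(i := (g i)(x := r))) i' x') ` insert (i, x) E"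
    proof
      fix p assume "p \<in> {int n<..N}"
      then obtain i' x' where "(i', x') \<in> E" "p = g i' x'" using t'(4) by auto
      then show "p \<in> (\<lambda>(i', x'). (g(i := (g i)(x := r))) i' x') ` insert (i, x) E"
        using ne[of i' x'] by (intro image_eqI[of _ _ "(i', x')"]) auto
    qed
    show "(g(i := (g i)(x := r))) i' x' \<noteq> 0 \<and> I (wd n * ((g(i := (g i)(x := r))) i' (2 * x') + 1) +
         (g(i := (g i)(x := r))) i' (2 * x' + 1)) = (g(i := (g i)(x := r))) i' x'"
      if "(i', x') \<in> insert (i, x) E" for i' x'
      using that ne[of i' x'] t'(9)[of i' x'] r i(1-3) by auto
    show "cf ((g(i := (g i)(x := r))) i' x') j = of_bool (j \<in> leaves n x' \<and> M i' j)"
      if "(i', x') \<in> insert (i, x) E \<or> n \<le> x' \<and> x' < 2 * n" for i' x' j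
      using that c t'(11)[of i' x' j] i(1-3) by auto
    show "0 \<le> (g(i := (g i)(x := r))) i' x' \<and> (g(i := (g i)(x := r))) i' x' \<le> N" for i' x'
      using t'(10)[of i' x'] d by auto
    show "(g(i := (g i)(x := r))) i' x' = (if M i' (x' - n) then int (x' - n) + 1 else 0)"
      if "n \<le> x'" "x' < 2 * n" for i' x' using t'(12)[OF that, of i'] that i(1-3) by auto
  qed ((rule t'(7) t'(8); assumption) | (use t'(1-3,5,6) i(1-3) in auto)[1])+
qed

text \<open>The ghost vector of the fresh name \<open>N + 1\<close> is defined as the sum of its
  children's vectors; old names, all at most \<open>N\<close>, keep theirs. The new dictionary entry
  sits at a key that was still 0 and so belongs to no processed pair.\<close>

lemma tables_new:
  assumes t: "tables n M E g cf N I"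
    and i: "i < n" "0 < x" "x < n" "\<And>x'. (i, x') \<in> E \<longleftrightarrow> x < x' \<and> x' < n"
    and ab: "a = g i (2 * x)" "b = g i (2 * x + 1)"
    and z: "I (wd n * (a + 1) + b) = 0"
    and N1: "N + 1 < wd n"
    and I': "I' (wd n * (a + 1) + b) = N + 1" "I' (-100 - wd n - (N + 1)) = a"
      "I' (-100 - 2 * wd n - (N + 1)) = b"
    and frame: "\<And>y. 0 < y \<or> -100 - 3 * wd n < y \<and> y \<le> -100 - wd n \<Longrightarrow>
      y \<noteq> wd n * (a + 1) + b \<Longrightarrow> y \<noteq> -100 - wd n - (N + 1) \<Longrightarrow> y \<noteq> -100 - 2 * wd n - (N + 1) \<Longrightarrow>
      I' y = I y"
  shows "tables n M (insert (i, x) E) (g(i := (g i)(x := N + 1)))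
    (cf(N + 1 := \<lambda>j. cf a j + cf b j)) (N + 1) I'"
proof -
  note t' = tablesD[OF t]
  define w where "w = wd n"
  have ne: "(i', x') \<in> E \<Longrightarrow> i' \<noteq> i \<or> 2 * x' \<noteq> x \<and> 2 * x' + 1 \<noteq> x \<and> x' \<noteq> x" for i' x'
    using i(4)[of x'] by auto
  have g: "0 \<le> g i' y" "g i' y \<le> N" for i' y using t'(10)[of i' y] by auto
  have a: "0 \<le> a" "a \<le> N" "0 \<le> b" "b \<le> N" using g ab by auto
  have w: "2 * int n \<le> w" "1 \<le> w" using wd_ge by (auto simp: w_def)
  have K: "w \<le> w * (a + 1)" using wd_key_bounds(1)[of a w b] a N1 by (simp add: w_def)
  have tab: "I' (-100 - w - p) = I (-100 - w - p)" "I' (-100 - 2 * w - p) = I (-100 - 2 * w - p)"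
    if "int n < p" "p \<le> N" for p
    unfolding w_def
    by (intro frame disjI2 conjI; use that N1 K w a in \<open>unfold w_def, linarith\<close>)+
  \<comment> \<open>Another key avoids the new dictionary cell by injectivity, and the two new child
    cells because keys are positive.\<close>
  have dict: "I' (w * (a' + 1) + b') = I (w * (a' + 1) + b')"
    if "0 \<le> a'" "a' < w" "0 \<le> b'" "b' < w" "(a', b') \<noteq> (a, b)" for a' b'
  proof -
    have k: "0 < w * (a' + 1) + b'" using wd_key_bounds(1)[OF that(1-4)] that w by linarith
    show ?thesis unfolding w_def
    proof (rule frame)
      show "wd n * (a' + 1) + b' \<noteq> wd n * (a + 1) + b"
        using wd_key_inj[of w a' b' a b] that a N1 by (auto simp: w_def)
    qed (use k w t'(3) in \<open>auto simp: w_def\<close>)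
  qed
  have inp: "I' (1 + int k) = I (1 + int k)" if "k < n * n" for k
  proof (rule frame)
    have "1 + int k < w" using that unfolding w_def wd_def
      by (metis add.commute add_strict_right_mono of_nat_less_iff of_nat_mult)
    then show "1 + int k \<noteq> wd n * (a + 1) + b" using K a unfolding w_def by linarith
  qed (use w t'(3) in \<open>auto simp: w_def\<close>)
  have "(i, 2 * x) \<in> E \<or> n \<le> 2 * x \<and> 2 * x < 2 * n"
    "(i, 2 * x + 1) \<in> E \<or> n \<le> 2 * x + 1 \<and> 2 * x + 1 < 2 * n" using i(1-3) i(4)[of "2 * x"] i(4)[of "2 * x + 1"] by auto
  then have c: "cf a j + cf b j = of_bool (j \<in> leaves n x \<and> M i j)" for j
    unfolding ab using t'(11) leaves_node[OF i(2,3)] leaves_siblings_disjoint[OF i(2), of n]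
    by auto
  let ?g = "g(i := (g i)(x := N + 1))"
  let ?cf = "cf(N + 1 := \<lambda>j. cf a j + cf b j)"
  have cf: "?cf p = cf p" if "p \<le> N" for p using that by auto
  show ?thesis
  proof (rule tables.intro)
    show "{int n<..N + 1} \<subseteq> (\<lambda>(i', x'). ?g i' x') ` insert (i, x) E"
    proof
      fix p assume p: "p \<in> {int n<..N + 1}"
      show "p \<in> (\<lambda>(i', x'). ?g i' x') ` insert (i, x) E"
      proof (cases "p = N + 1")
        case True
        then show ?thesis by (intro image_eqI[of _ _ "(i, x)"]) auto
      next
        case False
        then have "p \<in> {int n<..N}" using p by auto
        then obtain i' x' where "(i', x') \<in> E" "p = g i' x'" using t'(4) by auto
        then show ?thesis using ne[of i' x'] by (intro image_eqI[of _ _ "(i', x')"]) auto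
      qed
    qed
    show "?g i' x' \<noteq> 0 \<and> I' (wd n * (?g i' (2 * x') + 1) + ?g i' (2 * x' + 1)) = ?g i' x'"
      if "(i', x') \<in> insert (i, x) E" for i' x'
    proof (cases "(i', x') = (i, x)")
      case True
      then show ?thesis using I'(1) t'(3) ab i(1-3) by auto
    next
      case False
      then have e: "(i', x') \<in> E" using that by auto
      \<comment> \<open>A processed pair has a nonzero dictionary entry, whereas the entry for
        \<open>(a, b)\<close> was still 0.\<close>
      have "(g i' (2 * x'), g i' (2 * x' + 1)) \<noteq> (a, b)" using t'(9)[OF e] z by auto
      then have "I' (w * (g i' (2 * x') + 1) + g i' (2 * x' + 1)) = g i' x'"
        using dict[of "g i' (2 * x')" "g i' (2 * x' + 1)"] g[of i' "2 * x'"] g[of i' "2 * x' + 1"]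
          N1 t'(9)[OF e] by (simp add: w_def)
      then show ?thesis using ne[OF e] t'(9)[OF e] by (auto simp: w_def)
    qed
    show "a' \<le> N + 1 \<and> b' \<le> N + 1 \<and> int n < I' (wd n * (a' + 1) + b') \<and> I' (wd n * (a' + 1) + b') \<le> N + 1 \<and>
        (\<forall>j. ?cf (I' (wd n * (a' + 1) + b')) j = ?cf a' j + ?cf b' j)"
      if ab': "0 \<le> a'" "a' < wd n" "0 \<le> b'" "b' < wd n" "I' (wd n * (a' + 1) + b') \<noteq> 0" for a' b'
    proof (cases "(a', b') = (a, b)")
      case True
      then show ?thesis using I'(1) t'(3) a by auto
    next
      case False
      then have "I' (w * (a' + 1) + b') = I (w * (a' + 1) + b')" using dict ab' by (simp add: w_def)
      then show ?thesis using t'(8)[of a' b'] ab' by (simp add: w_def cf)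
    qed
    show "0 \<le> I' (- 100 - wd n - p) \<and> I' (- 100 - wd n - p) < p \<and>
         0 \<le> I' (- 100 - 2 * wd n - p) \<and> I' (- 100 - 2 * wd n - p) < p \<and>
         (\<forall>j. ?cf p j = ?cf (I' (- 100 - wd n - p)) j + ?cf (I' (- 100 - 2 * wd n - p)) j)"
      if p: "int n < p" "p \<le> N + 1" for p
    proof (cases "p = N + 1")
      case True
      then show ?thesis using I' a by auto
    next
      case False
      then show ?thesis using p t'(7)[of p] tab[of p] by (auto simp: w_def)
    qed
    show "?cf (?g i' x') j = of_bool (j \<in> leaves n x' \<and> M i' j)"
      if "(i', x') \<in> insert (i, x) E \<or> n \<le> x' \<and> x' < 2 * n" for i' x' j
      using that c t'(11)[of i' x' j] g[of i' x'] i(1-3) by auto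
    show "0 \<le> ?g i' x' \<and> ?g i' x' \<le> N + 1" for i' x'
      using g[of i' x'] t'(3) by auto
    show "?g i' x' = (if M i' (x' - n) then int (x' - n) + 1 else 0)"
      if "n \<le> x'" "x' < 2 * n" for i' x' using t'(12)[OF that, of i'] that i(1-3) by auto
  qed (use t'(1-3,5,6) i(1-3) inp in auto)
qed

section \<open>The nested loops of the preprocessing\<close>

definition roots :: "nat \<Rightarrow> nat \<Rightarrow> (nat \<Rightarrow> nat \<Rightarrow> int) \<Rightarrow> (int \<Rightarrow> int) \<Rightarrow> bool" where
  "roots n m g I \<longleftrightarrow> (\<forall>i<m. I (-100 - 3 * wd n - int i) = g i 1)"

lemma preprocess_init:
  assumes "4 * wd n + 100 \<le> B"
  shows "after preprocess B 9 (\<lambda>(pc, I', R'). pc = 9 \<and> R' = R \<and> bnd B I' \<and> scalars n (int n) I' \<and>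
      I' (-9) = 0 \<and> I' (-16) = 1 \<and> (\<forall>y. y \<notin> {-1, -3, -4, -5, -6, -7, -8, -16} \<longrightarrow> I' y = fst (snd (pre_init n M)) y))
     (0, fst (snd (pre_init n M)), R)"
proof -
  define I where "I = fst (snd (pre_init n M))"
  have w: "2 * int n \<le> wd n" "1 \<le> wd n" using wd_ge by auto
  have I: "I 0 = int n" "\<And>y. y < 0 \<Longrightarrow> I y = 0" by (auto simp: I_def pre_init_def)
  have "bnd B I" unfolding bnd_def I_def using assms w by (auto simp: pre_init_def)
  then show ?thesis unfolding I_def[symmetric] using assms w I
    by (auto simp: after_step_numeral after_step preprocess_def scalars_def wd_def simp del: after.simps(2))
qed

lemma preprocess_leaf_loop:
  assumes "bnd B I" "scalars n N I" "i < n" "I (-10) = 0" "I (-16) = 1 + int (i * n)"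
    "4 * wd n + 100 \<le> B" "\<And>k. k < n * n \<Longrightarrow> I (1 + int k) = (if M (k div n) (k mod n) then 1 else 0)"
  shows "reaches preprocess B (10 * n) (12, I, R) (\<lambda>(pc, I', R'). pc = 12 \<and> R' = R \<and> bnd B I' \<and>
     I' (-10) = int n \<and> I' (-16) = 1 + int (i * n) + int n \<and>
     (\<forall>j<n. I' (-100 - int (n + j)) = (if M i j then int j + 1 else 0)) \<and>
     (\<forall>y. y \<notin> {-10, -11, -12, -16} \<and> \<not> (-100 - 2 * int n < y \<and> y \<le> -100) \<longrightarrow> I' y = I y))"
proof (rule reaches_mono)
  define Inv where "Inv j = (\<lambda>(pc, I', R'). pc = (12::nat) \<and> R' = R \<and> bnd B I' \<and>
     I' (-10) = int j \<and> I' (-16) = 1 + int (i * n) + int j \<and>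
     (\<forall>j'<j. I' (-100 - int (n + j')) = (if M i j' then int j' + 1 else 0)) \<and>
     (\<forall>y. y \<notin> {-10, -11, -12, -16} \<and> \<not> (-100 - 2 * int n < y \<and> y \<le> -100) \<longrightarrow> I' y = I y))" for j
  have w: "2 * int n \<le> wd n" "1 \<le> wd n" using wd_ge by auto
  show "reaches preprocess B (10 * n) (12, I, R) (Inv n)"
  proof (rule reaches_loop)
    show "Inv 0 (12, I, R)" using assms by (simp add: Inv_def)
    show "bnd B (fst (snd (12::nat, I, R)))" using assms by simp
    fix j s assume j: "j < n" and "Inv j s"
    then obtain I' where s: "s = (12, I', R)" and inv: "bnd B I'"
      "I' (-10) = int j" "I' (-16) = 1 + int (i * n) + int j"
      "\<And>j'. j' < j \<Longrightarrow> I' (-100 - int (n + j')) = (if M i j' then int j' + 1 else 0)"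
      "\<And>y. y \<notin> {-10, -11, -12, -16} \<Longrightarrow> \<not> (-100 - 2 * int n < y \<and> y \<le> -100) \<Longrightarrow> I' y = I y"
      by (cases s) (auto simp: Inv_def)
    \<comment> \<open>The program stores \<open>b * (j + 1)\<close>, so a 0-1 entry selects name 0
      or name \<open>j + 1\<close> without a branch.\<close>
    define b :: int where "b = (if M i j then 1 else 0)"
    have k: "i * n + j < n * n"
    proof -
      have "i * n + j < Suc i * n" using j by simp
      also have "\<dots> \<le> n * n" using assms(3) by (intro mult_le_mono1) simp
      finally show ?thesis .
    qed
    then have kw: "int (i * n) + int j < wd n" unfolding wd_def
      by (metis of_nat_add of_nat_less_iff of_nat_mult zless_add1_eq)
    have pos: "0 < 1 + int (i * n) + int j" using of_nat_0_le_iff[of "i * n"] by linarith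
    have "I' (1 + int (i * n + j)) = I (1 + int (i * n + j))" 
      by (rule inv(5)) (auto simp del: of_nat_add of_nat_mult)
    then have "I' (1 + int (i * n) + int j) = b"
      using assms(7)[OF k] j by (simp add: b_def add.assoc)
    then have "after preprocess B 10 (\<lambda>(pc, I'', R'). pc = 12 \<and> R' = R \<and> bnd B I'' \<and> I'' (-10) = int (Suc j) \<and>
       I'' (-16) = (1 + int (i * n) + int j) + 1 \<and> I'' (-100 - int (n + j)) = b * int (Suc j) \<and>
       (\<forall>y. y \<notin> {-10, -11, -12, -16, -100 - int (n + j)} \<longrightarrow> I'' y = I' y)) (12, I', R)"
      using assms(2,6) inv j w kw pos
      by (intro preprocess_leaf_step) (auto simp: scalars_def b_def)
    from reaches_after[OF this order_refl]
    show "reaches preprocess B 10 s (Inv (Suc j))" unfolding s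
    proof (rule reaches_mono)
      fix s' :: state assume "case s' of (pc, I'', R') \<Rightarrow> pc = 12 \<and> R' = R \<and> bnd B I'' \<and> I'' (-10) = int (Suc j) \<and>
       I'' (-16) = (1 + int (i * n) + int j) + 1 \<and> I'' (-100 - int (n + j)) = b * int (Suc j) \<and>
       (\<forall>y. y \<notin> {-10, -11, -12, -16, -100 - int (n + j)} \<longrightarrow> I'' y = I' y)"
      then obtain I'' where s': "s' = (12, I'', R)" "bnd B I''" "I'' (-10) = int (Suc j)"
       "I'' (-16) = (1 + int (i * n) + int j) + 1" "I'' (-100 - int (n + j)) = b * int (Suc j)"
       "\<And>y. y \<notin> {-10, -11, -12, -16, -100 - int (n + j)} \<Longrightarrow> I'' y = I' y"
        by (cases s') auto
      have "I'' (-100 - int (n + j')) = (if M i j' then int j' + 1 else 0)" if "j' < Suc j" for j'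
      proof (cases "j' = j")
        case False
        then show ?thesis using that s'(6) inv(4)[of j'] by simp
      qed (use s'(5) in \<open>simp add: b_def\<close>)
      moreover have "I'' y = I y" if "y \<notin> {-10, -11, -12, -16}" "\<not> (-100 - 2 * int n < y \<and> y \<le> -100)" for y
        using inv(5)[OF that] s'(6)[of y] that j by auto
      ultimately show "Inv (Suc j) s'" using s' by (simp add: Inv_def)
    qed simp
  qed
  show "Inv n s' \<Longrightarrow> (\<lambda>(pc, I', R'). pc = 12 \<and> R' = R \<and> bnd B I' \<and>
     I' (-10) = int n \<and> I' (-16) = 1 + int (i * n) + int n \<and>
     (\<forall>j<n. I' (-100 - int (n + j)) = (if M i j then int j + 1 else 0)) \<and>
     (\<forall>y. y \<notin> {-10, -11, -12, -16} \<and> \<not> (-100 - 2 * int n < y \<and> y \<le> -100) \<longrightarrow> I' y = I y)) s'" for s'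
    by (simp add: Inv_def)
qed simp

text \<open>The ghost data are existentially quantified because each new name extends them. After
  \<open>k\<close> rounds the positions from \<open>n - k\<close> upwards are named in row
  \<open>i\<close>, and register \<open>-10\<close> holds the next one.\<close>

definition node_inv where
  "node_inv n M B R i q k = (\<lambda>(pc, I, R'). pc = (24::nat) \<and> R' = R \<and> bnd B I \<and>
     I (-10) = int n - 1 - int k \<and> I (-9) = int i \<and> I (-16) = q \<and>
     (\<exists>g cf N. scalars n N I \<and> tables n M ({..<i} \<times> {1..<n} \<union> {i} \<times> {n - k..<n}) g cf N I \<and>
        (\<forall>x. n - k \<le> x \<and> x < 2 * n \<longrightarrow> I (-100 - int x) = g i x) \<and> roots n i g I))"

lemma node_invI:
  assumes "bnd B I" "I (-10) = int n - 1 - int k" "I (-9) = int i" "I (-16) = q"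
    "scalars n N I" "tables n M E g cf N I" "E = {..<i} \<times> {1..<n} \<union> {i} \<times> {n - k..<n}"
    "\<And>x. n - k \<le> x \<Longrightarrow> x < 2 * n \<Longrightarrow> I (-100 - int x) = g i x"
    "\<And>i'. i' < i \<Longrightarrow> I (-100 - 3 * wd n - int i') = g i' 1"
  shows "node_inv n M B R i q k (24, I, R)"
  unfolding node_inv_def prod.case roots_def using assms by blast

lemma preprocess_node_step:
  assumes i: "i < n" and k: "k < n - 1" and B: "wd n * wd n + 3 * wd n + 100 \<le> B"
    and inv: "node_inv n M B R i q k s"
  shows "reaches preprocess B 22 s (node_inv n M B R i q (Suc k))"
proof -
  obtain I g cf N where s: "s = (24, I, R)" and I: "bnd B I" "I (-10) = int n - 1 - int k"
      "I (-9) = int i" "I (-16) = q" "scalars n N I"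
    and t: "tables n M ({..<i} \<times> {1..<n} \<union> {i} \<times> {n - k..<n}) g cf N I"
    and H: "\<And>x. n - k \<le> x \<Longrightarrow> x < 2 * n \<Longrightarrow> I (-100 - int x) = g i x"
    and rt: "\<And>i'. i' < i \<Longrightarrow> I (-100 - 3 * wd n - int i') = g i' 1"
    using inv by (cases s) (auto simp: node_inv_def roots_def)
  define x where "x = n - Suc k"
  define E where "E = {..<i} \<times> {1..<n} \<union> {i} \<times> {n - k..<n}"
  have x: "0 < x" "x < n" "n - k = Suc x" "I (-10) = int x" "n - Suc k = x"
    using k I(2) by (auto simp: x_def)
  have E: "(i, x') \<in> E \<longleftrightarrow> x < x' \<and> x' < n" for x' using x by (auto simp: E_def)
  have E': "insert (i, x) E = {..<i} \<times> {1..<n} \<union> {i} \<times> {n - Suc k..<n}"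
    using x by (auto simp: E_def)
  note t = t[folded E_def]
  have w: "2 * int n \<le> wd n" "1 \<le> wd n" using wd_ge by auto
  define a b where "a = g i (2 * x)" and "b = g i (2 * x + 1)"
  have ab: "0 \<le> a" "a < wd n" "0 \<le> b" "b < wd n"
    using tables.range[OF t] tables_card(2)[OF t] unfolding a_def b_def by (meson le_less_trans)+
  have Hab: "I (-100 - 2 * int x) = a" "I (-101 - 2 * int x) = b"
    using H[of "2 * x"] H[of "2 * x + 1"] x by (auto simp: a_def b_def)
  have key: "wd n \<le> wd n * (a + 1)" using wd_key_bounds(1)[OF ab] .
  have Nw: "N < wd n" "int n \<le> N" using tables_card(2)[OF t] tables.count[OF t] by auto
  show ?thesis
  proof (cases "I (wd n * (a + 1) + b) = 0")
    case False
    define r where "r = I (wd n * (a + 1) + b)"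
    have "after preprocess B 16 (\<lambda>(pc, I', R'). pc = 24 \<and> R' = R \<and> bnd B I' \<and> I' (-10) = int x - 1 \<and>
      I' (-100 - int x) = r \<and>
      (\<forall>y. y \<notin> {-10, -11, -12, -13, -14, -15, -100 - int x} \<longrightarrow> I' y = I y)) (24, I, R)"
      using I(1,5) x(4,1,2) Hab ab r_def[symmetric] False[folded r_def] B w
      by (intro preprocess_found_step) auto
    from reaches_after[OF this, of 22] show ?thesis unfolding s
    proof (rule reaches_mono)
      fix s' :: state assume "case s' of (pc, I', R') \<Rightarrow> pc = 24 \<and> R' = R \<and> bnd B I' \<and> I' (-10) = int x - 1 \<and>
        I' (-100 - int x) = r \<and>
        (\<forall>y. y \<notin> {-10, -11, -12, -13, -14, -15, -100 - int x} \<longrightarrow> I' y = I y)"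
      then obtain I' where s': "s' = (24, I', R)" "bnd B I'" "I' (-10) = int x - 1" "I' (-100 - int x) = r"
        and fr: "\<And>y. y \<notin> {-10, -11, -12, -13, -14, -15, -100 - int x} \<Longrightarrow> I' y = I y"
        by (cases s') auto
      let ?g = "g(i := (g i)(x := r))"
      have "tables n M (insert (i, x) E) ?g cf N I"
        using tables_found[OF t i x(1,2) E] r_def False unfolding a_def b_def by simp
      then have "tables n M (insert (i, x) E) ?g cf N I'"
        by (rule tables_cong) (rule fr, use w x(2) in auto)
      moreover have "scalars n N I'" using I(5) fr by (auto simp: scalars_def)
      moreover have "I' (-100 - int x') = ?g i x'" if "x \<le> x'" "x' < 2 * n" for x'
      proof (cases "x' = x")
        case False
        then show ?thesis using H[of x'] fr[of "-100 - int x'"] that x(3) by simp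
      qed (use s' in simp)
      moreover have "I' (-100 - 3 * wd n - int i') = ?g i' 1" if "i' < i" for i'
        using rt[OF that] fr[of "-100 - 3 * wd n - int i'"] w x(2) that by auto
      moreover have "I' (-9) = int i" "I' (-16) = q" using fr I by auto
      moreover have "I' (-10) = int n - 1 - int (Suc k)" using s'(3) I(2) x(4) by simp
      ultimately show "node_inv n M B R i q (Suc k) s'"
        unfolding s'(1) using s'(2) E' x(5) by (intro node_invI[where g = ?g]) auto
    qed simp_all
  next
    case True
    \<comment> \<open>The pair \<open>(i, x)\<close> is still outside \<open>E\<close>, so
      \<open>E\<close> misses at least one of the \<open>n * (n - 1)\<close> pairs, which leaves
      room for the name \<open>N + 1\<close> below \<open>w\<close>.\<close>
    have "card (insert (i, x) E) \<le> card ({..<n} \<times> {1..<n})"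
      using tables.dom[OF t] i x by (intro card_mono) auto
    moreover have "card (insert (i, x) E) = Suc (card E)"
      using E tables.dom[OF t] by (subst card_insert_disjoint) (auto intro: finite_subset)
    ultimately have "Suc (card E) \<le> n * (n - 1)" by (simp add: card_cartesian_product)
    then have "n + Suc (card E) \<le> n * n" by (cases n) auto
    then have "int n + int (card E) + 1 \<le> int n * int n"
      by (metis add.assoc add.commute of_nat_Suc of_nat_add of_nat_le_iff of_nat_mult)
    then have N1: "N + 1 < wd n" using tables_card(1)[OF t] by (simp add: wd_def)
    have "after preprocess B 22 (\<lambda>(pc, I', R'). pc = 24 \<and> R' = R \<and> bnd B I' \<and> I' (-10) = int x - 1 \<and>
     I' (-100 - int x) = N + 1 \<and> I' (-8) = N + 1 \<and> I' (wd n * (a + 1) + b) = N + 1 \<and>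
     I' (-100 - wd n - (N + 1)) = a \<and> I' (-100 - 2 * wd n - (N + 1)) = b \<and>
     (\<forall>y. y \<notin> {-8, -10, -11, -12, -13, -14, -15, -100 - int x, wd n * (a + 1) + b,
        -100 - wd n - (N + 1), -100 - 2 * wd n - (N + 1)} \<longrightarrow> I' y = I y)) (24, I, R)"
      using I(1,5) x(4,1,2) Hab ab True N1 Nw B
      by (intro preprocess_new_step) auto
    from reaches_after[OF this, of 22] show ?thesis unfolding s
    proof (rule reaches_mono)
      fix s' :: state assume "case s' of (pc, I', R') \<Rightarrow> pc = 24 \<and> R' = R \<and> bnd B I' \<and> I' (-10) = int x - 1 \<and>
        I' (-100 - int x) = N + 1 \<and> I' (-8) = N + 1 \<and> I' (wd n * (a + 1) + b) = N + 1 \<and>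
        I' (-100 - wd n - (N + 1)) = a \<and> I' (-100 - 2 * wd n - (N + 1)) = b \<and>
        (\<forall>y. y \<notin> {-8, -10, -11, -12, -13, -14, -15, -100 - int x, wd n * (a + 1) + b,
          -100 - wd n - (N + 1), -100 - 2 * wd n - (N + 1)} \<longrightarrow> I' y = I y)"
      then obtain I' where s': "s' = (24, I', R)" "bnd B I'" "I' (-10) = int x - 1"
          "I' (-100 - int x) = N + 1" "I' (-8) = N + 1"
        and new: "I' (wd n * (a + 1) + b) = N + 1"
          "I' (-100 - wd n - (N + 1)) = a" "I' (-100 - 2 * wd n - (N + 1)) = b"
        and fr: "\<And>y. y \<notin> {-8, -10, -11, -12, -13, -14, -15, -100 - int x, wd n * (a + 1) + b,
          -100 - wd n - (N + 1), -100 - 2 * wd n - (N + 1)} \<Longrightarrow> I' y = I y"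
        by (cases s') auto
      have keyp: "0 < wd n * (a + 1) + b" using key ab w by linarith
      let ?g = "g(i := (g i)(x := N + 1))"
      have "tables n M (insert (i, x) E) ?g (cf(N + 1 := \<lambda>j. cf a j + cf b j)) (N + 1) I'"
        by (rule tables_new[OF t i x(1,2) E a_def b_def True N1 new])
          (rule fr, use w x(2) in auto)
      moreover have "scalars n (N + 1) I'" using I(5) s'(5) fr keyp Nw w by (auto simp: scalars_def)
      moreover have "I' (-100 - int x') = ?g i x'" if "x \<le> x'" "x' < 2 * n" for x'
      proof (cases "x' = x")
        case False
        then show ?thesis using H[of x'] fr[of "-100 - int x'"] that x(3) keyp Nw w by auto
      qed (use s' in simp)
      moreover have "I' (-100 - 3 * wd n - int i') = ?g i' 1" if "i' < i" for i'
        using rt[OF that] fr[of "-100 - 3 * wd n - int i'"] w x(2) that keyp N1 by auto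
      moreover have "I' (-9) = int i" "I' (-16) = q" using fr I keyp Nw w by auto
      moreover have "I' (-10) = int n - 1 - int (Suc k)" using s'(3) I(2) x(4) by simp
      ultimately show "node_inv n M B R i q (Suc k) s'"
        unfolding s'(1) using s'(2) E' x(5) by (intro node_invI[where g = ?g]) auto
    qed simp_all
  qed
qed

definition row_inv where
  "row_inv n M B R i = (\<lambda>(pc, I, R'). pc = (9::nat) \<and> R' = R \<and> bnd B I \<and>
     I (-9) = int i \<and> I (-16) = 1 + int (i * n) \<and>
     (\<exists>g cf N. scalars n N I \<and> tables n M ({..<i} \<times> {1..<n}) g cf N I \<and> roots n i g I))"

text \<open>A row costs 10 steps for each of its \<open>n\<close> leaves and at most 22 for each of
  its \<open>n - 1\<close> internal positions; the rest is constant.\<close>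

lemma preprocess_row_step:
  assumes i: "i < n" and B: "wd n * wd n + 4 * wd n + 100 \<le> B"
    and inv: "row_inv n M B R i s"
  shows "reaches preprocess B (32 * n + 16) s (row_inv n M B R (Suc i))"
proof -
  obtain I g cf N where s: "s = (9, I, R)" and I: "bnd B I" "I (-9) = int i"
      "I (-16) = 1 + int (i * n)" "scalars n N I"
    and t: "tables n M ({..<i} \<times> {1..<n}) g cf N I"
    and rt: "\<And>i'. i' < i \<Longrightarrow> I (-100 - 3 * wd n - int i') = g i' 1"
    using inv by (cases s) (auto simp: row_inv_def roots_def)
  have w: "2 * int n \<le> wd n" "1 \<le> wd n" using wd_ge by auto
  moreover have "0 \<le> wd n * wd n" by simp
  ultimately have B4: "4 * wd n + 100 \<le> B" "0 \<le> B" using B by linarith+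
  have "after preprocess B 2 (\<lambda>(pc, I', R'). pc = 12 \<and> R' = R \<and> bnd B I' \<and> I' = I(-10 := 0)) (9, I, R)"
    using I i B B4 w by (auto simp: after_step_numeral after_step preprocess_def scalars_def simp del: after.simps(2))
  from reaches_after[OF this order_refl] show ?thesis unfolding s
  proof (rule reaches_trans)
    fix s1 :: state assume "case s1 of (pc, I', R') \<Rightarrow> pc = 12 \<and> R' = R \<and> bnd B I' \<and> I' = I(-10 := 0)"
    then have s1: "s1 = (12, I(-10 := 0), R)" "bnd B (I(-10 := 0))" by (cases s1; simp)+
    have "reaches preprocess B (10 * n) (12, I(-10 := 0), R) (\<lambda>(pc, I', R'). pc = 12 \<and> R' = R \<and> bnd B I' \<and>
     I' (-10) = int n \<and> I' (-16) = 1 + int (i * n) + int n \<and>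
     (\<forall>j<n. I' (-100 - int (n + j)) = (if M i j then int j + 1 else 0)) \<and>
     (\<forall>y. y \<notin> {-10, -11, -12, -16} \<and> \<not> (-100 - 2 * int n < y \<and> y \<le> -100) \<longrightarrow> I' y = (I(-10 := 0)) y))"
      using s1 I i B B4 w tables.input[OF t]
      by (intro preprocess_leaf_loop[OF s1(2)]) (auto simp: scalars_def simp del: of_nat_mult)
    then show "reaches preprocess B (32 * n + 14) s1 (row_inv n M B R (Suc i))" unfolding s1(1)
    proof (rule reaches_trans)
      fix s2 :: state assume "case s2 of (pc, I', R') \<Rightarrow> pc = 12 \<and> R' = R \<and> bnd B I' \<and>
        I' (-10) = int n \<and> I' (-16) = 1 + int (i * n) + int n \<and>
        (\<forall>j<n. I' (-100 - int (n + j)) = (if M i j then int j + 1 else 0)) \<and>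
        (\<forall>y. y \<notin> {-10, -11, -12, -16} \<and> \<not> (-100 - 2 * int n < y \<and> y \<le> -100) \<longrightarrow> I' y = (I(-10 := 0)) y)"
      then obtain I2 where s2: "s2 = (12, I2, R)" "bnd B I2" "I2 (-10) = int n"
          "I2 (-16) = 1 + int (i * n) + int n"
        and H: "\<And>j. j < n \<Longrightarrow> I2 (-100 - int (n + j)) = (if M i j then int j + 1 else 0)"
        and fr: "\<And>y. y \<notin> {-10, -11, -12, -16} \<Longrightarrow> \<not> (-100 - 2 * int n < y \<and> y \<le> -100) \<Longrightarrow> I2 y = I y"
        by (cases s2) auto
      define q where "q = 1 + int (i * n) + int n"
      have sc2: "scalars n N I2" using I(4) fr unfolding scalars_def by auto
      have t2: "tables n M ({..<i} \<times> {1..<n}) g cf N I2"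
        using t by (rule tables_cong) (rule fr, use w in auto)
      have "after preprocess B 3 (\<lambda>(pc, I', R'). pc = 24 \<and> R' = R \<and> bnd B I' \<and> I' = I2(-10 := int n - 1)) (12, I2, R)"
        using s2 sc2 i B B4 w by (auto simp: after_step_numeral after_step preprocess_def scalars_def simp del: after.simps(2))
      from reaches_after[OF this order_refl]
      show "reaches preprocess B (22 * n + 14) s2 (row_inv n M B R (Suc i))" unfolding s2(1)
      proof (rule reaches_trans)
        fix s3 :: state assume "case s3 of (pc, I', R') \<Rightarrow> pc = 24 \<and> R' = R \<and> bnd B I' \<and> I' = I2(-10 := int n - 1)"
        then obtain I3 where s3: "s3 = (24, I3, R)" "bnd B I3" "I3 = I2(-10 := int n - 1)" by (cases s3) simp
        have t3: "tables n M ({..<i} \<times> {1..<n}) g cf N I3"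
          unfolding s3(3) using t2 by (rule tables_cong) (use w in auto)
        have "node_inv n M B R i q 0 s3" unfolding s3(1)
        proof (rule node_invI[OF s3(2) _ _ _ _ t3])
          show "I3 (-100 - int x) = g i x" if "n - 0 \<le> x" "x < 2 * n" for x
          proof -
            have "I3 (-100 - int x) = (if M i (x - n) then int (x - n) + 1 else 0)"
              using H[of "x - n"] that by (simp add: s3(3))
            then show ?thesis using tables.leaf[OF t3, of x i] that by simp
          qed
          show "I3 (-100 - 3 * wd n - int i') = g i' 1" if "i' < i" for i'
            using rt[OF that] fr[of "-100 - 3 * wd n - int i'"] w by (auto simp: s3(3))
          show "I3 (-9) = int i" using fr[of "-9"] I by (simp add: s3(3))
        qed (use s2 sc2 in \<open>auto simp: s3(3) scalars_def q_def\<close>)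
        then have "reaches preprocess B (22 * (n - 1)) s3 (node_inv n M B R i q (n - 1))"
          using preprocess_node_step[OF i] B w s3 by (intro reaches_loop) auto
        then show "reaches preprocess B (22 * n + 11) s3 (row_inv n M B R (Suc i))"
        proof (rule reaches_trans)
          fix s4 assume "node_inv n M B R i q (n - 1) s4"
          then obtain I4 g' cf' N' where s4: "s4 = (24, I4, R)" and I4: "bnd B I4" "I4 (-10) = 0"
            "I4 (-9) = int i" "I4 (-16) = q" "scalars n N' I4"
            and t4: "tables n M ({..<i} \<times> {1..<n} \<union> {i} \<times> {1..<n}) g' cf' N' I4"
            and H4: "\<And>x. 1 \<le> x \<Longrightarrow> x < 2 * n \<Longrightarrow> I4 (-100 - int x) = g' i x"
            and rt4: "\<And>i'. i' < i \<Longrightarrow> I4 (-100 - 3 * wd n - int i') = g' i' 1"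
            using i by (cases s4) (auto simp: node_inv_def roots_def of_nat_diff)
          \<comment> \<open>For \<open>n = 1\<close> the root is itself a leaf; the heap cell of
            position 1 holds its name in either case.\<close>
          have "I4 (-101) = g' i 1" using H4[of 1] i by simp
          then have "after preprocess B 8 (\<lambda>(pc, I', R'). pc = 9 \<and> R' = R \<and> bnd B I' \<and> I' (-9) = int (Suc i) \<and>
            I' (-100 - 3 * wd n - int i) = g' i 1 \<and>
            (\<forall>y. y \<notin> {-9, -11, -12, -100 - 3 * wd n - int i} \<longrightarrow> I' y = I4 y)) (24, I4, R)"
            using I4 i B B4 w by (intro preprocess_root_step) auto
          from reaches_after[OF this order_refl]
          show "reaches preprocess B 8 s4 (row_inv n M B R (Suc i))" unfolding s4
          proof (rule reaches_mono)
            fix s5 :: state assume "case s5 of (pc, I', R') \<Rightarrow> pc = 9 \<and> R' = R \<and> bnd B I' \<and> I' (-9) = int (Suc i) \<and>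
              I' (-100 - 3 * wd n - int i) = g' i 1 \<and>
              (\<forall>y. y \<notin> {-9, -11, -12, -100 - 3 * wd n - int i} \<longrightarrow> I' y = I4 y)"
            then obtain I5 where s5: "s5 = (9, I5, R)" "bnd B I5" "I5 (-9) = int (Suc i)"
              "I5 (-100 - 3 * wd n - int i) = g' i 1"
              and fr5: "\<And>y. y \<notin> {-9, -11, -12, -100 - 3 * wd n - int i} \<Longrightarrow> I5 y = I4 y"
              by (cases s5) auto
            have "{..<i} \<times> {1..<n} \<union> {i} \<times> {1..<n} = {..<Suc i} \<times> {1..<n}"
              by (auto simp: less_Suc_eq)
            note t4 = t4[unfolded this]
            have "tables n M ({..<Suc i} \<times> {1..<n}) g' cf' N' I5"
              using t4 by (rule tables_cong) (rule fr5, use w in auto)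
            moreover have "scalars n N' I5" using I4(5) fr5 w unfolding scalars_def by auto
            moreover have "roots n (Suc i) g' I5" unfolding roots_def
            proof (intro allI impI)
              fix i' assume "i' < Suc i"
              then show "I5 (-100 - 3 * wd n - int i') = g' i' 1"
                using rt4[of i'] s5(4) fr5[of "-100 - 3 * wd n - int i'"] w
                by (cases "i' = i") auto
            qed
            moreover have "I5 (-16) = 1 + int (Suc i * n)"
              using fr5[of "-16"] I4(4) w by (simp add: q_def)
            ultimately show "row_inv n M B R (Suc i) s5"
              unfolding row_inv_def s5(1) prod.case using s5(2,3) by blast
          qed simp
        qed (use i in simp)
      qed simp
    qed simp
  qed simp
qed

text \<open>The interface to the queries: heap, dictionary, \<open>E\<close> and \<open>g\<close>
  are forgotten, and only the circuit and its roots remain. Both children have smaller names than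
  their parent, so the numerical order of names is a topological order.\<close>

definition ready :: "nat \<Rightarrow> (nat \<Rightarrow> nat \<Rightarrow> bool) \<Rightarrow> (int \<Rightarrow> nat \<Rightarrow> real) \<Rightarrow> int \<Rightarrow> (int \<Rightarrow> int) \<Rightarrow> bool" where
  "ready n M cf N I \<longleftrightarrow> scalars n N I \<and> int n \<le> N \<and> N < wd n \<and>
     (\<forall>j. cf 0 j = 0) \<and> (\<forall>c<n. \<forall>j. cf (int c + 1) j = of_bool (j = c)) \<and>
     (\<forall>p. int n < p \<and> p \<le> N \<longrightarrow>
        0 \<le> I (-100 - wd n - p) \<and> I (-100 - wd n - p) < p \<and>
        0 \<le> I (-100 - 2 * wd n - p) \<and> I (-100 - 2 * wd n - p) < p \<and>
        (\<forall>j. cf p j = cf (I (-100 - wd n - p)) j + cf (I (-100 - 2 * wd n - p)) j)) \<and>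
     (\<forall>i<n. 0 \<le> I (-100 - 3 * wd n - int i) \<and> I (-100 - 3 * wd n - int i) \<le> N \<and>
        (\<forall>j<n. cf (I (-100 - 3 * wd n - int i)) j = of_bool (M i j)))"

text \<open>The step count depends on \<open>n\<close> alone; twin-width enters only through the
  bound on \<open>N\<close>, the size of the circuit handed to the queries.\<close>

lemma preprocess_correct:
  assumes B: "wd n * wd n + 4 * wd n + 100 \<le> B" and d: "twin_width n M = d"
  shows "reaches preprocess B ((32 * n + 16) * n + 11) (pre_init n M) (\<lambda>(pc, I, R). pc = 54 \<and> bnd B I \<and>
    (\<exists>cf N. ready n M cf N I \<and>
      real_of_int N \<le> real n + real n * (real (d * 2 ^ d) * (2 * ln (real (n + 2)) / ln 2 + 1) + 2)))"
proof -
  define I0 where "I0 = fst (snd (pre_init n M))"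
  define R0 where "R0 = snd (snd (pre_init n M))"
  have s0: "pre_init n M = (0, I0, R0)" by (simp add: I0_def R0_def pre_init_def)
  have w: "2 * int n \<le> wd n" "1 \<le> wd n" using wd_ge by auto
  moreover have "0 \<le> wd n * wd n" by simp
  ultimately have B4: "4 * wd n + 100 \<le> B" "0 \<le> B" using B by linarith+
  have "after preprocess B 9 (\<lambda>(pc, I', R'). pc = 9 \<and> R' = R0 \<and> bnd B I' \<and> scalars n (int n) I' \<and>
      I' (-9) = 0 \<and> I' (-16) = 1 \<and> (\<forall>y. y \<notin> {-1, -3, -4, -5, -6, -7, -8, -16} \<longrightarrow> I' y = I0 y)) (0, I0, R0)"
    unfolding I0_def using B B4 w by (intro preprocess_init) auto
  from reaches_after[OF this order_refl] show ?thesis unfolding s0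
  proof (rule reaches_trans)
    fix s1 :: state assume "case s1 of (pc, I', R') \<Rightarrow> pc = 9 \<and> R' = R0 \<and> bnd B I' \<and> scalars n (int n) I' \<and>
      I' (-9) = 0 \<and> I' (-16) = 1 \<and> (\<forall>y. y \<notin> {-1, -3, -4, -5, -6, -7, -8, -16} \<longrightarrow> I' y = I0 y)"
    then obtain I1 where s1: "s1 = (9, I1, R0)" "bnd B I1" "scalars n (int n) I1"
      "I1 (-9) = 0" "I1 (-16) = 1"
      and fr: "\<And>y. y \<notin> {-1, -3, -4, -5, -6, -7, -8, -16} \<Longrightarrow> I1 y = I0 y"
      by (cases s1) auto
    \<comment> \<open>Before any row is read the leaves already have their names; internal positions
      get the default 0, which is harmless while \<open>E\<close> is empty.\<close>
    define g where "g i x = (if n \<le> x \<and> x < 2 * n \<and> M i (x - n) then int (x - n) + 1 else 0)" for i x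
    define cf :: "int \<Rightarrow> nat \<Rightarrow> real" where "cf p j = of_bool (p = int j + 1)" for p j
    have t: "tables n M ({..<0} \<times> {1..<n}) g cf (int n) I1"
    proof (rule tables.intro)
      show "I1 (1 + int k) = (if M (k div n) (k mod n) then 1 else 0)" if "k < n * n" for k
      proof -
        have "1 + int k \<le> int (n * n)" using that by linarith
        moreover have "nat (1 + int k - 1) = k" by simp
        ultimately show ?thesis using fr[of "1 + int k"] by (simp add: I0_def pre_init_def del: of_nat_mult)
      qed
      show "cf (g i x) j = of_bool (j \<in> leaves n x \<and> M i j)"
        if "(i, x) \<in> {..<0} \<times> {1..<n} \<or> n \<le> x \<and> x < 2 * n" for i x j
        using that by (auto simp: leaves_leaf g_def cf_def)
      show "a \<le> int n \<and> b \<le> int n \<and> int n < I1 (wd n * (a + 1) + b) \<and> I1 (wd n * (a + 1) + b) \<le> int n \<and>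
         (\<forall>j. cf (I1 (wd n * (a + 1) + b)) j = cf a j + cf b j)"
        if ab: "0 \<le> a" "a < wd n" "0 \<le> b" "b < wd n" and nz: "I1 (wd n * (a + 1) + b) \<noteq> 0" for a b
      proof -
        \<comment> \<open>Every key lies beyond the input cells, where the initial memory is zero:
          the dictionary starts out empty.\<close>
        have "wd n \<le> wd n * (a + 1) + b" using wd_key_bounds(1)[OF ab] ab by linarith
        then have "I1 (wd n * (a + 1) + b) = 0"
          using fr[of "wd n * (a + 1) + b"] w by (auto simp: I0_def pre_init_def wd_def)
        then show ?thesis using nz by simp
      qed
    qed (auto simp: g_def cf_def)
    have "row_inv n M B R0 0 s1" unfolding row_inv_def s1(1) roots_def using s1 t by auto
    then have "reaches preprocess B ((32 * n + 16) * n) s1 (row_inv n M B R0 n)"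
      using preprocess_row_step[OF _ B] s1 by (intro reaches_loop) auto
    then show "reaches preprocess B ((32 * n + 16) * n + 2) s1 (\<lambda>(pc, I, R). pc = 54 \<and> bnd B I \<and>
      (\<exists>cf N. ready n M cf N I \<and>
      real_of_int N \<le> real n + real n * (real (d * 2 ^ d) * (2 * ln (real (n + 2)) / ln 2 + 1) + 2)))"
    proof (rule reaches_trans)
      fix s2 assume "row_inv n M B R0 n s2"
      then obtain I2 g cf N where s2: "s2 = (9, I2, R0)" "bnd B I2" "I2 (-9) = int n"
        and sc: "scalars n N I2" and t: "tables n M ({..<n} \<times> {1..<n}) g cf N I2"
        and rt: "\<And>i. i < n \<Longrightarrow> I2 (-100 - 3 * wd n - int i) = g i 1"
        by (cases s2) (auto simp: row_inv_def roots_def)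
      have "ready n M cf N I2" unfolding ready_def
      proof (intro conjI allI impI)
        fix i j assume i: "i < n" "j < n"
        have "(i, 1) \<in> {..<n} \<times> {1..<n} \<or> n \<le> 1 \<and> 1 < 2 * n" using i by auto
        then have "cf (g i 1) j = of_bool (j \<in> leaves n 1 \<and> M i j)" by (rule tables.cf_row[OF t])
        then show "cf (I2 (- 100 - 3 * wd n - int i)) j = of_bool (M i j)"
          using i leaves_root[of n] rt[OF i(1)] by simp
      qed (use sc tables_card[OF t] tables.count[OF t] tables.cf_zero[OF t] tables.cf_leaf[OF t]
          tables.children[OF t] tables.range[OF t] rt in simp_all)
      moreover have "real_of_int N \<le> real n + real n * (real (d * 2 ^ d) * (2 * ln (real (n + 2)) / ln 2 + 1) + 2)"
      proof -
        \<comment> \<open>The final dictionary itself serves as the function \<open>D\<close>: by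
          \<open>found\<close>, every internal name is the entry at the key of its children.\<close>
        have "real (card ((\<lambda>(i, x). g i x) ` ({..<n} \<times> {1..<n})))
          \<le> real n * (real (d * 2 ^ d) * (2 * ln (real (n + 2)) / ln 2 + 1) + 2)"
          using tables.leaf[OF t] tables.found[OF t] d
          by (intro card_nodes_le[where h = "\<lambda>x b. if b then int (x - n) + 1 else 0"
                and D = "\<lambda>a b. I2 (wd n * (a + 1) + b)"]) auto
        moreover have "card {int n<..N} \<le> card ((\<lambda>(i, x). g i x) ` ({..<n} \<times> {1..<n}))"
          using tables.used[OF t] by (intro card_mono) auto
        then have "N \<le> int n + int (card ((\<lambda>(i, x). g i x) ` ({..<n} \<times> {1..<n})))" by simp
        then have "real_of_int N \<le> real n + real (card ((\<lambda>(i, x). g i x) ` ({..<n} \<times> {1..<n})))"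
          by linarith
        ultimately show ?thesis by linarith
      qed
      ultimately have "after preprocess B 2 (\<lambda>(pc, I, R). pc = 54 \<and> bnd B I \<and>
        (\<exists>cf N. ready n M cf N I \<and>
        real_of_int N \<le> real n + real n * (real (d * 2 ^ d) * (2 * ln (real (n + 2)) / ln 2 + 1) + 2))) s2"
        unfolding s2(1) using s2 sc
        by (auto simp: after_step_numeral after_step preprocess_def scalars_def simp del: after.simps(2))
      then show "reaches preprocess B 2 s2 (\<lambda>(pc, I, R). pc = 54 \<and> bnd B I \<and>
        (\<exists>cf N. ready n M cf N I \<and>
        real_of_int N \<le> real n + real n * (real (d * 2 ^ d) * (2 * ln (real (n + 2)) / ln 2 + 1) + 2)))"
        by (rule reaches_after) simp
    qed simp
  qed simp
qed

section \<open>Queries\<close>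

lemma reaches_mono':
  assumes "reaches P B T s (\<lambda>(pc, I, R). \<Psi> pc I R)" "\<And>pc I R. \<Psi> pc I R \<Longrightarrow> \<Phi> (pc, I, R)" "T \<le> T'"
  shows "reaches P B T' s \<Phi>"
  using assms(1) by (rule reaches_mono) (use assms in auto)

lemma reaches_trans':
  assumes "reaches P B T1 s (\<lambda>(pc, I, R). \<Psi> pc I R)"
    "\<And>pc I R. \<Psi> pc I R \<Longrightarrow> reaches P B T2 (pc, I, R) \<Phi>" "T1 + T2 \<le> T"
  shows "reaches P B T s \<Phi>"
  using assms(1) by (rule reaches_trans) (use assms in auto)

text \<open>These four are the only integer registers that the queries write, so the circuit
  survives throughout a query.\<close>

lemma ready_cong:
  assumes "ready n M cf N I" "\<And>y. y \<notin> {-9, -10, -11, -12} \<Longrightarrow> I' y = I y"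
  shows "ready n M cf N I'"
proof -
  have "scalars n N I'" using assms unfolding ready_def scalars_def by auto
  moreover have "I' (-100 - wd n - p) = I (-100 - wd n - p)"
    "I' (-100 - 2 * wd n - p) = I (-100 - 2 * wd n - p)" if "int n < p" for p
    using that wd_ge[of n] by (intro assms; auto)+
  moreover have "I' (-100 - 3 * wd n - int i) = I (-100 - 3 * wd n - int i)" for i
    using wd_ge[of n] by (intro assms) auto
  ultimately show ?thesis using assms(1) unfolding ready_def by simp
qed

text \<open>The queries keep one real per node \<open>p\<close> in the real register \<open>100 + p\<close>.\<close>

definition mat_query :: "instr list" where
  "mat_query = [
    ICONST (-10) 100, RSUB 0 0 0, RSTORE (-10) 0, ICONST (-9) 0,
    JLT (-9) 0 6, JZ (-2) 13,
    ISUB (-11) (-2) (-9), ISUB (-11) (-11) (-1), RLOAD 0 (-11), IADD (-9) (-9) (-1),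
    IADD (-11) (-10) (-9), RSTORE (-11) 0, JZ (-2) 4,
    JLT (-9) (-8) 15, JZ (-2) 28,
    IADD (-9) (-9) (-1), ISUB (-11) (-5) (-9), ILOAD (-11) (-11), IADD (-11) (-10) (-11),
    RLOAD 0 (-11), ISUB (-11) (-6) (-9), ILOAD (-11) (-11), IADD (-11) (-10) (-11), RLOAD 1 (-11),
    RADD 0 0 1, IADD (-11) (-10) (-9), RSTORE (-11) 0, JZ (-2) 13,
    ICONST (-9) 0,
    JLT (-9) 0 31, JZ (-2) 40,
    ISUB (-11) (-7) (-9), ILOAD (-11) (-11), IADD (-11) (-10) (-11), RLOAD 0 (-11),
    ISUB (-11) (-2) (-9), ISUB (-11) (-11) (-1), RSTORE (-11) 0, IADD (-9) (-9) (-1), JZ (-2) 29,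
    HALT]"

section \<open>Symbolic execution of the query loop bodies\<close>

lemma mat_query_leaf_step:
  assumes "bnd B I" "scalars n N I" "I (-10) = 100" "I (-9) = int j" "j < n" "4 * wd n + 100 \<le> B"
  shows "after mat_query B 8 (\<lambda>(pc, I', R'). pc = 4 \<and> bnd B I' \<and> I' (-9) = int (Suc j) \<and>
     (\<forall>y. y \<notin> {-9, -11} \<longrightarrow> I' y = I y) \<and> R' (100 + int (Suc j)) = R (-int j - 1) \<and>
     (\<forall>y. y \<noteq> 0 \<and> y \<noteq> 100 + int (Suc j) \<longrightarrow> R' y = R y)) (4, I, R)"
  using assms wd_ge[of n]
  by (auto simp: after_step_numeral after_step mat_query_def scalars_def simp del: after.simps(2))

lemma mat_query_node_step:
  assumes "bnd B I" "scalars n N I" "I (-10) = 100" "I (-9) = p - 1" "int n < p" "p \<le> N" "N < wd n"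
    "I (-100 - wd n - p) = l" "0 \<le> l" "l < p" "I (-100 - 2 * wd n - p) = r" "0 \<le> r" "r < p"
    "4 * wd n + 100 \<le> B"
  shows "after mat_query B 14 (\<lambda>(pc, I', R'). pc = 13 \<and> bnd B I' \<and> I' (-9) = p \<and>
     (\<forall>y. y \<notin> {-9, -11} \<longrightarrow> I' y = I y) \<and> R' (100 + p) = R (100 + l) + R (100 + r) \<and>
     (\<forall>y. y \<notin> {0, 1} \<and> y \<noteq> 100 + p \<longrightarrow> R' y = R y)) (13, I, R)"
  using assms wd_ge[of n]
  by (auto simp: after_step_numeral after_step mat_query_def scalars_def simp del: after.simps(2))

lemma mat_query_out_step:
  assumes "bnd B I" "scalars n N I" "I (-10) = 100" "I (-9) = int i" "i < n"
    "I (-100 - 3 * wd n - int i) = r" "0 \<le> r" "r < wd n" "4 * wd n + 100 \<le> B"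
  shows "after mat_query B 10 (\<lambda>(pc, I', R'). pc = 29 \<and> bnd B I' \<and> I' (-9) = int (Suc i) \<and>
     (\<forall>y. y \<notin> {-9, -11} \<longrightarrow> I' y = I y) \<and> R' (-int i - 1) = R (100 + r) \<and>
     (\<forall>y. y \<noteq> 0 \<and> y \<noteq> -int i - 1 \<longrightarrow> R' y = R y)) (29, I, R)"
  using assms wd_ge[of n]
  by (auto simp: after_step_numeral after_step mat_query_def scalars_def simp del: after.simps(2))

text \<open>Internal names are visited downwards from \<open>N\<close>, so a node's weight is
  complete before it is pushed: all its parents have larger names.\<close>

definition vec_query :: "instr list" where
  "vec_query = [
    ICONST (-10) 100, RSUB 0 0 0, ICONST (-9) 0,
    JLT (-9) (-8) 5, JZ (-2) 9,
    IADD (-9) (-9) (-1), IADD (-11) (-10) (-9), RSTORE (-11) 0, JZ (-2) 3,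
    ICONST (-9) 0,
    JLT (-9) 0 12, JZ (-2) 23,
    ISUB (-11) (-2) (-9), ISUB (-11) (-11) (-1), RLOAD 0 (-11), ISUB (-11) (-7) (-9),
    ILOAD (-11) (-11), IADD (-11) (-10) (-11), RLOAD 1 (-11), RADD 1 1 0, RSTORE (-11) 1,
    IADD (-9) (-9) (-1), JZ (-2) 10,
    IADD (-9) (-8) (-2),
    JLT 0 (-9) 26, JZ (-2) 42,
    IADD (-11) (-10) (-9), RLOAD 0 (-11),
    ISUB (-11) (-5) (-9), ILOAD (-11) (-11), IADD (-11) (-10) (-11), RLOAD 1 (-11), RADD 1 1 0,
    RSTORE (-11) 1,
    ISUB (-11) (-6) (-9), ILOAD (-11) (-11), IADD (-11) (-10) (-11), RLOAD 1 (-11), RADD 1 1 0,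
    RSTORE (-11) 1, ISUB (-9) (-9) (-1), JZ (-2) 24,
    ICONST (-9) 0,
    JLT (-9) 0 45, JZ (-2) 52,
    ISUB (-11) (-2) (-9), ISUB (-11) (-11) (-1), IADD (-9) (-9) (-1), IADD (-12) (-10) (-9),
    RLOAD 0 (-12), RSTORE (-11) 0, JZ (-2) 43,
    HALT]"

lemma vec_query_zero_step:
  assumes "bnd B I" "scalars n N I" "I (-10) = 100" "I (-9) = int k" "int k < N" "N < wd n" "R 0 = 0"
    "4 * wd n + 100 \<le> B"
  shows "after vec_query B 5 (\<lambda>(pc, I', R'). pc = 3 \<and> bnd B I' \<and> I' (-9) = int (Suc k) \<and>
     (\<forall>y. y \<notin> {-9, -11} \<longrightarrow> I' y = I y) \<and> R' (100 + int (Suc k)) = 0 \<and>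
     (\<forall>y. y \<noteq> 100 + int (Suc k) \<longrightarrow> R' y = R y)) (3, I, R)"
  using assms wd_ge[of n]
  by (auto simp: after_step_numeral after_step vec_query_def scalars_def simp del: after.simps(2))

lemma vec_query_root_step:
  assumes "bnd B I" "scalars n N I" "I (-10) = 100" "I (-9) = int i" "i < n"
    "I (-100 - 3 * wd n - int i) = r" "0 \<le> r" "r < wd n" "4 * wd n + 100 \<le> B"
  shows "after vec_query B 12 (\<lambda>(pc, I', R'). pc = 10 \<and> bnd B I' \<and> I' (-9) = int (Suc i) \<and>
     (\<forall>y. y \<notin> {-9, -11} \<longrightarrow> I' y = I y) \<and>
     (\<forall>y. y \<notin> {0, 1} \<longrightarrow> R' y = R y + (if y = 100 + r then R (-int i - 1) else 0))) (10, I, R)"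
  using assms wd_ge[of n]
  by (auto simp: after_step_numeral after_step vec_query_def scalars_def simp del: after.simps(2))

text \<open>The two children may coincide, for instance both be 0; the weight must then arrive
  twice. Hence the two separate summands, and in the program a fresh load for the second child after
  the first store.\<close>

lemma vec_query_push_step:
  assumes "bnd B I" "scalars n N I" "I (-10) = 100" "I (-9) = p" "int n < p" "p \<le> N" "N < wd n"
    "I (-100 - wd n - p) = l" "0 \<le> l" "l < p" "I (-100 - 2 * wd n - p) = r" "0 \<le> r" "r < p"
    "4 * wd n + 100 \<le> B"
  shows "after vec_query B 17 (\<lambda>(pc, I', R'). pc = 24 \<and> bnd B I' \<and> I' (-9) = p - 1 \<and>
     (\<forall>y. y \<notin> {-9, -11} \<longrightarrow> I' y = I y) \<and>
     (\<forall>y. y \<notin> {0, 1} \<longrightarrow> R' y = R y + (if y = 100 + l then R (100 + p) else 0) +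
        (if y = 100 + r then R (100 + p) else 0))) (24, I, R)"
  using assms wd_ge[of n]
  by (auto simp: after_step_numeral after_step vec_query_def scalars_def simp del: after.simps(2))

lemma vec_query_out_step:
  assumes "bnd B I" "scalars n N I" "I (-10) = 100" "I (-9) = int j" "j < n" "4 * wd n + 100 \<le> B"
  shows "after vec_query B 8 (\<lambda>(pc, I', R'). pc = 43 \<and> bnd B I' \<and> I' (-9) = int (Suc j) \<and>
     (\<forall>y. y \<notin> {-9, -11, -12} \<longrightarrow> I' y = I y) \<and> R' (-int j - 1) = R (101 + int j) \<and>
     (\<forall>y. y \<noteq> 0 \<and> y \<noteq> -int j - 1 \<longrightarrow> R' y = R y)) (43, I, R)"
  using assms wd_ge[of n]
  by (auto simp: after_step_numeral after_step vec_query_def scalars_def simp del: after.simps(2))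

section \<open>Correctness of the two queries\<close>

lemma readyD:
  assumes "ready n M cf N I"
  shows "scalars n N I" "int n \<le> N" "N < wd n" "\<And>j. cf 0 j = 0"
    "\<And>c j. c < n \<Longrightarrow> cf (int c + 1) j = of_bool (j = c)"
    "\<And>p. int n < p \<Longrightarrow> p \<le> N \<Longrightarrow> 0 \<le> I (-100 - wd n - p) \<and> I (-100 - wd n - p) < p \<and>
        0 \<le> I (-100 - 2 * wd n - p) \<and> I (-100 - 2 * wd n - p) < p"
    "\<And>p j. int n < p \<Longrightarrow> p \<le> N \<Longrightarrow>
        cf p j = cf (I (-100 - wd n - p)) j + cf (I (-100 - 2 * wd n - p)) j"
    "\<And>i. i < n \<Longrightarrow> 0 \<le> I (-100 - 3 * wd n - int i) \<and> I (-100 - 3 * wd n - int i) \<le> N"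
    "\<And>i j. i < n \<Longrightarrow> j < n \<Longrightarrow> cf (I (-100 - 3 * wd n - int i)) j = of_bool (M i j)"
  using assms unfolding ready_def by blast+

text \<open>\<open>val q\<close> is the product of the vector named \<open>q\<close> with
  \<open>v\<close>. Since children precede parents, one ascending pass computes all values, with a
  single real addition per internal name, and the answers are read off at the row roots.\<close>

lemma mat_query_correct:
  assumes rd: "ready n M cf N I" and b: "bnd B I" and B: "4 * wd n + 100 \<le> B"
    and inp: "\<And>j. j < n \<Longrightarrow> R (-int j - 1) = v j"
  shows "reaches mat_query B (14 * nat N + 18 * n + 11) (0, I, R)
    (\<lambda>(pc, I', R'). pc = 40 \<and> (\<forall>i<n. R' (-int i - 1) = mat_vec n M v i))"
proof -
  have w: "2 * int n \<le> wd n" "1 \<le> wd n" using wd_ge by auto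
  note rdD = readyD[OF rd]
  define val where "val q = (\<Sum>j<n. cf q j * v j)" for q
  define good where "good I' \<longleftrightarrow> bnd B I' \<and> ready n M cf N I' \<and> I' (-10) = 100" for I'
  have keep: "good I''" if "good I'" "bnd B I''" "\<forall>y. y \<notin> {-9, -11} \<longrightarrow> I'' y = I' y" for I' I''
    unfolding good_def using that ready_cong[of n M cf N I' I''] by (auto simp: good_def)
  have val0: "val 0 = 0" by (simp add: val_def rdD(4))
  have val_leaf: "val (int c + 1) = v c" if "c < n" for c
    using that by (simp add: val_def rdD(5) of_bool_def if_distrib[where f = "\<lambda>x. x * _"] cong: if_cong)
  define L1 where "L1 j = (\<lambda>(pc, I', R'). pc = (4::nat) \<and> good I' \<and> I' (-9) = int j \<and>
    (\<forall>q. 0 \<le> q \<and> q \<le> int j \<longrightarrow> R' (100 + q) = val q) \<and> (\<forall>j<n. R' (-int j - 1) = v j))" for j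
  define L2 where "L2 k = (\<lambda>(pc, I', R'). pc = (13::nat) \<and> good I' \<and> I' (-9) = int n + int k \<and>
    (\<forall>q. 0 \<le> q \<and> q \<le> int n + int k \<longrightarrow> R' (100 + q) = val q))" for k
  define L3 where "L3 i = (\<lambda>(pc, I', R'). pc = (29::nat) \<and> good I' \<and> I' (-9) = int i \<and>
    (\<forall>q. 0 \<le> q \<and> q \<le> N \<longrightarrow> R' (100 + q) = val q) \<and> (\<forall>i'<i. R' (-int i' - 1) = mat_vec n M v i'))" for i
  have step1: "reaches mat_query B 8 s (L1 (Suc j))" if j: "j < n" and s: "L1 j s" for j s
  proof -
    obtain I' R' where s': "s = (4, I', R')" "good I'" "I' (-9) = int j"
      "\<And>q. 0 \<le> q \<Longrightarrow> q \<le> int j \<Longrightarrow> R' (100 + q) = val q" "\<And>j. j < n \<Longrightarrow> R' (-int j - 1) = v j"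
      using s by (cases s) (auto simp: L1_def)
    have "after mat_query B 8 (\<lambda>(pc, I'', R''). pc = 4 \<and> bnd B I'' \<and> I'' (-9) = int (Suc j) \<and>
      (\<forall>y. y \<notin> {-9, -11} \<longrightarrow> I'' y = I' y) \<and> R'' (100 + int (Suc j)) = R' (-int j - 1) \<and>
      (\<forall>y. y \<noteq> 0 \<and> y \<noteq> 100 + int (Suc j) \<longrightarrow> R'' y = R' y)) (4, I', R')"
      using s' j B readyD(1)[of n M cf N I'] by (intro mat_query_leaf_step) (auto simp: good_def)
    from reaches_after[OF this order_refl] show ?thesis unfolding s'(1)
    proof (rule reaches_mono', goal_cases)
      case (1 pc I'' R'')
      have "R'' (100 + q) = val q" if "0 \<le> q" "q \<le> int (Suc j)" for q
      proof (cases "q = int (Suc j)")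
        case True
        then show ?thesis using 1 s'(5)[OF j] val_leaf[OF j] by (simp add: add.commute)
      next
        case False
        then have "R'' (100 + q) = R' (100 + q)" using 1 that by auto
        then show ?thesis using s'(4)[of q] that False by simp
      qed
      moreover have "R'' (-int c - 1) = v c" if "c < n" for c using 1 s'(5)[OF that] by auto
      ultimately show ?case using 1 keep[OF s'(2)] by (simp add: L1_def)
    qed simp
  qed
  have step2: "reaches mat_query B 14 s (L2 (Suc k))" if k: "k < nat (N - int n)" and s: "L2 k s" for k s
  proof -
    obtain I' R' where s': "s = (13, I', R')" "good I'" "I' (-9) = int n + int k"
      "\<And>q. 0 \<le> q \<Longrightarrow> q \<le> int n + int k \<Longrightarrow> R' (100 + q) = val q"
      using s by (cases s) (auto simp: L2_def)
    define p where "p = int n + int (Suc k)"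
    have p: "int n < p" "p \<le> N" "I' (-9) = p - 1" using k s'(3) by (auto simp: p_def)
    have rd': "ready n M cf N I'" using s'(2) by (simp add: good_def)
    note D = readyD[OF rd']
    define l r where "l = I' (-100 - wd n - p)" and "r = I' (-100 - 2 * wd n - p)"
    have lr: "0 \<le> l" "l < p" "0 \<le> r" "r < p" using D(6)[OF p(1,2)] by (auto simp: l_def r_def)
    have vp: "val p = val l + val r"
      unfolding val_def D(7)[OF p(1,2)] l_def r_def by (simp add: sum.distrib algebra_simps)
    have "after mat_query B 14 (\<lambda>(pc, I'', R''). pc = 13 \<and> bnd B I'' \<and> I'' (-9) = p \<and>
      (\<forall>y. y \<notin> {-9, -11} \<longrightarrow> I'' y = I' y) \<and> R'' (100 + p) = R' (100 + l) + R' (100 + r) \<and>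
      (\<forall>y. y \<notin> {0, 1} \<and> y \<noteq> 100 + p \<longrightarrow> R'' y = R' y)) (13, I', R')"
      using s'(2) p lr B D(1,3) l_def r_def by (intro mat_query_node_step) (auto simp: good_def)
    from reaches_after[OF this order_refl] show ?thesis unfolding s'(1)
    proof (rule reaches_mono', goal_cases)
      case (1 pc I'' R'')
      have "R'' (100 + q) = val q" if "0 \<le> q" "q \<le> p" for q
      proof (cases "q = p")
        case True
        then show ?thesis using 1 s'(4)[of l] s'(4)[of r] lr vp by (simp add: p_def)
      next
        case False
        then have "R'' (100 + q) = R' (100 + q)" using 1 that by auto
        then show ?thesis using s'(4)[of q] that False by (simp add: p_def)
      qed
      then show ?case using 1 keep[OF s'(2)] by (simp add: L2_def p_def)
    qed simp
  qed
  have step3: "reaches mat_query B 10 s (L3 (Suc i))" if i: "i < n" and s: "L3 i s" for i s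
  proof -
    obtain I' R' where s': "s = (29, I', R')" "good I'" "I' (-9) = int i"
      "\<And>q. 0 \<le> q \<Longrightarrow> q \<le> N \<Longrightarrow> R' (100 + q) = val q"
      "\<And>i'. i' < i \<Longrightarrow> R' (-int i' - 1) = mat_vec n M v i'"
      using s by (cases s) (auto simp: L3_def)
    have rd': "ready n M cf N I'" using s'(2) by (simp add: good_def)
    note D = readyD[OF rd']
    define r where "r = I' (-100 - 3 * wd n - int i)"
    have r: "0 \<le> r" "r \<le> N" using D(8)[OF i] by (auto simp: r_def)
    have vr: "val r = mat_vec n M v i"
      unfolding val_def mat_vec_def by (rule sum.cong) (auto simp: r_def D(9)[OF i])
    have "after mat_query B 10 (\<lambda>(pc, I'', R''). pc = 29 \<and> bnd B I'' \<and> I'' (-9) = int (Suc i) \<and>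
      (\<forall>y. y \<notin> {-9, -11} \<longrightarrow> I'' y = I' y) \<and> R'' (-int i - 1) = R' (100 + r) \<and>
      (\<forall>y. y \<noteq> 0 \<and> y \<noteq> -int i - 1 \<longrightarrow> R'' y = R' y)) (29, I', R')"
      using s'(2,3) i r B D(1,3) r_def by (intro mat_query_out_step) (auto simp: good_def)
    from reaches_after[OF this order_refl] show ?thesis unfolding s'(1)
    proof (rule reaches_mono', goal_cases)
      case (1 pc I'' R'')
      have "R'' (-int i' - 1) = mat_vec n M v i'" if "i' < Suc i" for i'
      proof (cases "i' = i")
        case True
        then show ?thesis using 1 s'(4)[OF r] vr by simp
      next
        case False
        then have "R'' (-int i' - 1) = R' (-int i' - 1)" using 1 by auto
        then show ?thesis using s'(5)[of i'] that False by simp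
      qed
      moreover have "R'' (100 + q) = val q" if "0 \<le> q" "q \<le> N" for q using 1 s'(4)[OF that] that by auto
      ultimately show ?case using 1 keep[OF s'(2)] by (simp add: L3_def)
    qed simp
  qed
  \<comment> \<open>The real constant 0 is obtained as \<open>R 0 - R 0\<close>, so no assumption on
    the real registers left by the preprocessing is made.\<close>
  have "L1 0 (Suc (Suc (Suc (Suc 0))), I(-10 := 100, -9 := 0), R(0 := 0, 100 := 0))"
    unfolding L1_def good_def prod.case using b B w inp rd val0 ready_cong[OF rd, of "I(-10 := 100, -9 := 0)"]
    by auto
  then have "after mat_query B 4 (L1 0) (0, I, R)"
    using b B w by (auto simp: after_step_numeral after_step mat_query_def simp del: after.simps(2))
  from reaches_after[OF this order_refl] show ?thesis
  proof (rule reaches_trans)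
    fix s1 assume s1: "L1 0 s1"
    have "reaches mat_query B (8 * n) s1 (L1 n)"
      using step1 s1 by (intro reaches_loop) (auto simp: L1_def good_def)
    then show "reaches mat_query B (14 * nat N + 18 * n + 7) s1
      (\<lambda>(pc, I', R'). pc = 40 \<and> (\<forall>i<n. R' (-int i - 1) = mat_vec n M v i))"
    proof (rule reaches_trans)
      fix s2 assume "L1 n s2"
      then have "after mat_query B 2 (L2 0) s2"
        using rdD(1) by (cases s2) (auto simp: L1_def L2_def good_def ready_def scalars_def after_step_numeral
            after_step mat_query_def simp del: after.simps(2))
      then have "reaches mat_query B 2 s2 (L2 0)" by (rule reaches_after) simp
      then show "reaches mat_query B (14 * nat N + 10 * n + 7) s2
        (\<lambda>(pc, I', R'). pc = 40 \<and> (\<forall>i<n. R' (-int i - 1) = mat_vec n M v i))"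
      proof (rule reaches_trans)
        fix s3 assume s3: "L2 0 s3"
        have "reaches mat_query B (14 * nat (N - int n)) s3 (L2 (nat (N - int n)))"
          using step2 s3 by (intro reaches_loop) (auto simp: L2_def good_def)
        then show "reaches mat_query B (14 * nat N + 10 * n + 5) s3
          (\<lambda>(pc, I', R'). pc = 40 \<and> (\<forall>i<n. R' (-int i - 1) = mat_vec n M v i))"
        proof (rule reaches_trans)
          fix s4 assume "L2 (nat (N - int n)) s4"
          then obtain I' R' where s4: "s4 = (13, I', R')" "good I'" "I' (-9) = N"
            "\<And>q. 0 \<le> q \<Longrightarrow> q \<le> N \<Longrightarrow> R' (100 + q) = val q"
            using rdD(2) by (cases s4) (auto simp: L2_def)
          then have "L3 0 (29, I'(-9 := 0), R')"
            using keep[of I' "I'(-9 := 0)"] B w by (auto simp: L3_def good_def)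
          then have "after mat_query B 3 (L3 0) s4"
            unfolding s4(1) using s4(2,3) B w rdD(2,3) by (auto simp: good_def ready_def scalars_def after_step_numeral
                after_step mat_query_def simp del: after.simps(2))
          from reaches_after[OF this order_refl]
          show "reaches mat_query B (10 * n + 5) s4
            (\<lambda>(pc, I', R'). pc = 40 \<and> (\<forall>i<n. R' (-int i - 1) = mat_vec n M v i))"
          proof (rule reaches_trans)
            fix s5 assume s5: "L3 0 s5"
            have "reaches mat_query B (10 * n) s5 (L3 n)"
              using step3 s5 by (intro reaches_loop) (auto simp: L3_def good_def)
            then show "reaches mat_query B (10 * n + 2) s5
              (\<lambda>(pc, I', R'). pc = 40 \<and> (\<forall>i<n. R' (-int i - 1) = mat_vec n M v i))"
            proof (rule reaches_trans)
              fix s6 assume "L3 n s6"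
              then have "after mat_query B 2 (\<lambda>(pc, I', R'). pc = 40 \<and>
                  (\<forall>i<n. R' (-int i - 1) = mat_vec n M v i)) s6"
                by (cases s6) (auto simp: L3_def good_def ready_def scalars_def after_step_numeral
                    after_step mat_query_def simp del: after.simps(2))
              then show "reaches mat_query B 2 s6
                (\<lambda>(pc, I', R'). pc = 40 \<and> (\<forall>i<n. R' (-int i - 1) = mat_vec n M v i))"
                by (rule reaches_after) simp
            qed simp
          qed simp
        qed (use rdD(2) in auto)
      qed simp
    qed simp
  qed simp
qed

lemma sum_indicator_times:
  fixes h :: "'a \<Rightarrow> real"
  assumes "finite A" "l \<in> A"
  shows "(\<Sum>q\<in>A. (if q = l then c else 0) * h q) = c * h l"
proof -
  have "(\<Sum>q\<in>A. (if q = l then c else 0) * h q) = (\<Sum>q\<in>A. if q = l then c * h q else 0)"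
    by (rule sum.cong) auto
  then show ?thesis using assms by simp
qed

text \<open>The invariant is the vector \<open>\<Sum>q \<le> p. R (100 + q) \<cdot> cf q\<close>: moving the weight of \<open>p\<close> to its two children
  preserves it, because \<open>cf p\<close> is the sum of the two children.\<close>

lemma vec_query_correct:
  assumes rd: "ready n M cf N I" and b: "bnd B I" and B: "4 * wd n + 100 \<le> B"
    and inp: "\<And>j. j < n \<Longrightarrow> R (-int j - 1) = v j"
  shows "reaches vec_query B (22 * nat N + 20 * n + 14) (0, I, R)
    (\<lambda>(pc, I', R'). pc = 52 \<and> (\<forall>j<n. R' (-int j - 1) = vec_mat n M v j))"
proof -
  let ?done = "\<lambda>(pc, I', R'). pc = (52::nat) \<and> (\<forall>j<n. R' (-int j - 1) = vec_mat n M v j)"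
  have w: "2 * int n \<le> wd n" "1 \<le> wd n" using wd_ge by auto
  note rdD = readyD[OF rd]
  define good where "good I' \<longleftrightarrow> bnd B I' \<and> ready n M cf N I' \<and> I' (-10) = 100" for I'
  have keep: "good I''" if "good I'" "bnd B I''" "\<forall>y. y \<notin> {-9, -11, -12} \<longrightarrow> I'' y = I' y" for I' I''
    unfolding good_def using that ready_cong[of n M cf N I' I''] by (auto simp: good_def)
  define pot where "pot R' p j = (\<Sum>q\<in>{0..p}. R' (100 + q) * cf q j)" for R' p j
  define L1 where "L1 k = (\<lambda>(pc, I', R'). pc = (3::nat) \<and> good I' \<and> I' (-9) = int k \<and> R' 0 = 0 \<and>
    (\<forall>q. 1 \<le> q \<and> q \<le> int k \<longrightarrow> R' (100 + q) = 0) \<and> (\<forall>j<n. R' (-int j - 1) = v j))" for k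
  define L2 where "L2 i = (\<lambda>(pc, I', R'). pc = (10::nat) \<and> good I' \<and> I' (-9) = int i \<and>
    (\<forall>j<n. pot R' N j = (\<Sum>i'<i. v i' * of_bool (M i' j))) \<and> (\<forall>j<n. R' (-int j - 1) = v j))" for i
  define L3 where "L3 k = (\<lambda>(pc, I', R'). pc = (24::nat) \<and> good I' \<and> I' (-9) = N - int k \<and>
    (\<forall>j<n. pot R' (N - int k) j = vec_mat n M v j))" for k
  define L4 where "L4 j = (\<lambda>(pc, I', R'). pc = (43::nat) \<and> good I' \<and> I' (-9) = int j \<and>
    (\<forall>c<n. R' (101 + int c) = vec_mat n M v c) \<and> (\<forall>c<j. R' (-int c - 1) = vec_mat n M v c))" for j
  have step1: "reaches vec_query B 5 s (L1 (Suc k))" if k: "k < nat N" and s: "L1 k s" for k s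
  proof -
    obtain I' R' where s': "s = (3, I', R')" "good I'" "I' (-9) = int k" "R' 0 = 0"
      "\<And>q. 1 \<le> q \<Longrightarrow> q \<le> int k \<Longrightarrow> R' (100 + q) = 0" "\<And>j. j < n \<Longrightarrow> R' (-int j - 1) = v j"
      using s by (cases s) (auto simp: L1_def)
    have "after vec_query B 5 (\<lambda>(pc, I'', R''). pc = 3 \<and> bnd B I'' \<and> I'' (-9) = int (Suc k) \<and>
      (\<forall>y. y \<notin> {-9, -11} \<longrightarrow> I'' y = I' y) \<and> R'' (100 + int (Suc k)) = 0 \<and>
      (\<forall>y. y \<noteq> 100 + int (Suc k) \<longrightarrow> R'' y = R' y)) (3, I', R')"
      using s' k B rdD(3) readyD(1)[of n M cf N I'] by (intro vec_query_zero_step) (auto simp: good_def)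
    from reaches_after[OF this order_refl] show ?thesis unfolding s'(1)
    proof (rule reaches_mono', goal_cases)
      case (1 pc I'' R'')
      have "R'' (100 + q) = 0" if "1 \<le> q" "q \<le> int (Suc k)" for q
        using 1 s'(5)[of q] that by (cases "q = int (Suc k)") auto
      moreover have "R'' (-int c - 1) = v c" if "c < n" for c using 1 s'(6)[OF that] by auto
      moreover have "R'' 0 = 0" using 1 s'(4) by auto
      ultimately show ?case using 1 keep[OF s'(2)] by (simp add: L1_def)
    qed simp
  qed
  have step2: "reaches vec_query B 12 s (L2 (Suc i))" if i: "i < n" and s: "L2 i s" for i s
  proof -
    obtain I' R' where s': "s = (10, I', R')" "good I'" "I' (-9) = int i"
      "\<And>j. j < n \<Longrightarrow> pot R' N j = (\<Sum>i'<i. v i' * of_bool (M i' j))"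
      "\<And>j. j < n \<Longrightarrow> R' (-int j - 1) = v j"
      using s by (cases s) (auto simp: L2_def)
    have rd': "ready n M cf N I'" using s'(2) by (simp add: good_def)
    note D = readyD[OF rd']
    define r where "r = I' (-100 - 3 * wd n - int i)"
    have r: "0 \<le> r" "r \<le> N" using D(8)[OF i] by (auto simp: r_def)
    have "after vec_query B 12 (\<lambda>(pc, I'', R''). pc = 10 \<and> bnd B I'' \<and> I'' (-9) = int (Suc i) \<and>
      (\<forall>y. y \<notin> {-9, -11} \<longrightarrow> I'' y = I' y) \<and>
      (\<forall>y. y \<notin> {0, 1} \<longrightarrow> R'' y = R' y + (if y = 100 + r then R' (-int i - 1) else 0))) (10, I', R')"
      using s'(2,3) i r B D(1,3) r_def by (intro vec_query_root_step) (auto simp: good_def)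
    from reaches_after[OF this order_refl] show ?thesis unfolding s'(1)
    proof (rule reaches_mono', goal_cases)
      case (1 pc I'' R'')
      have "pot R'' N j = (\<Sum>i'<Suc i. v i' * of_bool (M i' j))" if j: "j < n" for j
      proof -
        have "pot R'' N j = (\<Sum>q\<in>{0..N}. R' (100 + q) * cf q j + (if q = r then v i else 0) * cf q j)"
          unfolding pot_def by (rule sum.cong) (use 1 s'(5)[OF i] in \<open>auto simp: algebra_simps\<close>)
        also have "\<dots> = pot R' N j + v i * cf r j"
          using r unfolding sum.distrib pot_def by (subst sum_indicator_times) auto
        finally show ?thesis using s'(4)[OF j] D(9)[OF i j] by (simp add: r_def)
      qed
      moreover have "R'' (-int c - 1) = v c" if "c < n" for c using 1 s'(5)[OF that] r by auto
      ultimately show ?case using 1 keep[OF s'(2)] by (simp add: L2_def)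
    qed simp
  qed
  have step3: "reaches vec_query B 17 s (L3 (Suc k))" if k: "k < nat (N - int n)" and s: "L3 k s" for k s
  proof -
    obtain I' R' where s': "s = (24, I', R')" "good I'" "I' (-9) = N - int k"
      "\<And>j. j < n \<Longrightarrow> pot R' (N - int k) j = vec_mat n M v j"
      using s by (cases s) (auto simp: L3_def)
    define p where "p = N - int k"
    have p: "int n < p" "p \<le> N" "I' (-9) = p" using k s'(3) by (auto simp: p_def)
    have rd': "ready n M cf N I'" using s'(2) by (simp add: good_def)
    note D = readyD[OF rd']
    define l r where "l = I' (-100 - wd n - p)" and "r = I' (-100 - 2 * wd n - p)"
    have lr: "0 \<le> l" "l < p" "0 \<le> r" "r < p" using D(6)[OF p(1,2)] by (auto simp: l_def r_def)
    have "after vec_query B 17 (\<lambda>(pc, I'', R''). pc = 24 \<and> bnd B I'' \<and> I'' (-9) = p - 1 \<and>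
      (\<forall>y. y \<notin> {-9, -11} \<longrightarrow> I'' y = I' y) \<and>
      (\<forall>y. y \<notin> {0, 1} \<longrightarrow> R'' y = R' y + (if y = 100 + l then R' (100 + p) else 0) +
        (if y = 100 + r then R' (100 + p) else 0))) (24, I', R')"
      using s'(2) p lr B D(1,3) l_def r_def by (intro vec_query_push_step) (auto simp: good_def)
    from reaches_after[OF this order_refl] show ?thesis unfolding s'(1)
    proof (rule reaches_mono', goal_cases)
      case (1 pc I'' R'')
      define c where "c = R' (100 + p)"
      have "pot R'' (p - 1) j = vec_mat n M v j" if j: "j < n" for j
      proof -
        have "pot R'' (p - 1) j = (\<Sum>q\<in>{0..p - 1}. R' (100 + q) * cf q j +
            (if q = l then c else 0) * cf q j + (if q = r then c else 0) * cf q j)"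
          unfolding pot_def by (rule sum.cong) (use 1 in \<open>auto simp: algebra_simps c_def\<close>)
        also have "\<dots> = pot R' (p - 1) j + c * cf l j + c * cf r j"
          using lr unfolding sum.distrib pot_def by (simp add: sum_indicator_times)
        also have "\<dots> = pot R' (p - 1) j + c * cf p j"
          using D(7)[OF p(1,2), of j] by (simp add: l_def r_def algebra_simps)
        \<comment> \<open>The term \<open>c * cf p j\<close> is the summand of \<open>p\<close>
          itself, which the shorter range no longer contains.\<close>
        also have "\<dots> = pot R' p j"
        proof -
          have "{0..p} = insert p {0..p - 1}" using p by auto
          then show ?thesis unfolding pot_def by (simp add: c_def)
        qed
        finally show ?thesis using s'(4)[OF j] by (simp add: p_def)
      qed
      moreover have "p - 1 = N - int (Suc k)" by (simp add: p_def)
      ultimately show ?case using 1 keep[OF s'(2)] by (simp add: L3_def)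
    qed simp
  qed
  have step4: "reaches vec_query B 8 s (L4 (Suc j))" if j: "j < n" and s: "L4 j s" for j s
  proof -
    obtain I' R' where s': "s = (43, I', R')" "good I'" "I' (-9) = int j"
      "\<And>c. c < n \<Longrightarrow> R' (101 + int c) = vec_mat n M v c" "\<And>c. c < j \<Longrightarrow> R' (-int c - 1) = vec_mat n M v c"
      using s by (cases s) (auto simp: L4_def)
    have "after vec_query B 8 (\<lambda>(pc, I'', R''). pc = 43 \<and> bnd B I'' \<and> I'' (-9) = int (Suc j) \<and>
      (\<forall>y. y \<notin> {-9, -11, -12} \<longrightarrow> I'' y = I' y) \<and> R'' (-int j - 1) = R' (101 + int j) \<and>
      (\<forall>y. y \<noteq> 0 \<and> y \<noteq> -int j - 1 \<longrightarrow> R'' y = R' y)) (43, I', R')"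
      using s' j B readyD(1)[of n M cf N I'] by (intro vec_query_out_step) (auto simp: good_def)
    from reaches_after[OF this order_refl] show ?thesis unfolding s'(1)
    proof (rule reaches_mono', goal_cases)
      case (1 pc I'' R'')
      have "R'' (-int c - 1) = vec_mat n M v c" if "c < Suc j" for c
        using 1 s'(4)[OF j] s'(5)[of c] that by (cases "c = j") auto
      moreover have "R'' (101 + int c) = vec_mat n M v c" if "c < n" for c using 1 s'(4)[OF that] by auto
      ultimately show ?case using 1 keep[OF s'(2)] by (simp add: L4_def)
    qed simp
  qed
  have "L1 0 (Suc (Suc (Suc 0)), I(-10 := 100, -9 := 0), R(0 := 0))"
    unfolding L1_def good_def prod.case using b B w inp rd ready_cong[OF rd, of "I(-10 := 100, -9 := 0)"]
    by auto
  then have "after vec_query B 3 (L1 0) (0, I, R)"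
    using b B w by (auto simp: after_step_numeral after_step vec_query_def simp del: after.simps(2))
  from reaches_after[OF this order_refl] show ?thesis
  proof (rule reaches_trans)
    fix s1 assume s1: "L1 0 s1"
    have "reaches vec_query B (5 * nat N) s1 (L1 (nat N))"
      using step1 s1 by (intro reaches_loop) (auto simp: L1_def good_def)
    then show "reaches vec_query B (22 * nat N + 20 * n + 11) s1 ?done"
    proof (rule reaches_trans)
      fix s2 assume "L1 (nat N) s2"
      then obtain I' R' where s2: "s2 = (3, I', R')" "good I'" "I' (-9) = N"
        "\<And>q. 1 \<le> q \<Longrightarrow> q \<le> N \<Longrightarrow> R' (100 + q) = 0" "\<And>j. j < n \<Longrightarrow> R' (-int j - 1) = v j"
        using rdD(2) by (cases s2) (auto simp: L1_def)
      \<comment> \<open>The clearing loop starts at name 1. Register 100, the weight of name 0, may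
        hold anything, since \<open>cf 0\<close> vanishes.\<close>
      have "R' (100 + q) * cf q j = 0" if "q \<in> {0..N}" for q j
        using that s2(4)[of q] rdD(4) by (cases "q = 0") auto
      then have "pot R' N j = 0" for j unfolding pot_def by (simp add: sum.neutral)
      then have "L2 0 (10, I'(-9 := 0), R')"
        using s2 keep[of I' "I'(-9 := 0)"] B w by (auto simp: L2_def good_def)
      then have "after vec_query B 3 (L2 0) s2"
        unfolding s2(1) using s2(2,3) B w rdD(2,3) by (auto simp: good_def ready_def scalars_def after_step_numeral
            after_step vec_query_def simp del: after.simps(2))
      from reaches_after[OF this order_refl]
      show "reaches vec_query B (17 * nat N + 20 * n + 11) s2 ?done"
      proof (rule reaches_trans)
        fix s3 assume s3: "L2 0 s3"
        have "reaches vec_query B (12 * n) s3 (L2 n)"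
          using step2 s3 by (intro reaches_loop) (auto simp: L2_def good_def)
        then show "reaches vec_query B (17 * nat N + 20 * n + 8) s3 ?done"
        proof (rule reaches_trans)
          fix s4 assume "L2 n s4"
          then obtain I' R' where s4: "s4 = (10, I', R')" "good I'" "I' (-9) = int n"
            "\<And>j. j < n \<Longrightarrow> pot R' N j = (\<Sum>i'<n. v i' * of_bool (M i' j))"
            by (cases s4) (auto simp: L2_def)
          have "\<bar>N\<bar> \<le> B" using rdD(2,3) B w by auto
          moreover have "pot R' N j = vec_mat n M v j" if "j < n" for j
            using s4(4)[OF that] unfolding vec_mat_def by (simp add: of_bool_def)
          ultimately have "L3 0 (24, I'(-9 := N), R')"
            using s4 keep[of I' "I'(-9 := N)"] by (auto simp: L3_def good_def)
          then have "after vec_query B 3 (L3 0) s4"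
            unfolding s4(1) using s4(2,3) B w rdD(2,3) by (auto simp: good_def ready_def scalars_def after_step_numeral
                after_step vec_query_def simp del: after.simps(2))
          from reaches_after[OF this order_refl]
          show "reaches vec_query B (17 * nat N + 8 * n + 8) s4 ?done"
          proof (rule reaches_trans)
            fix s5 assume s5: "L3 0 s5"
            have "reaches vec_query B (17 * nat (N - int n)) s5 (L3 (nat (N - int n)))"
              using step3 s5 by (intro reaches_loop) (auto simp: L3_def good_def)
            then show "reaches vec_query B (17 * nat N + 8 * n + 5) s5 ?done"
            proof (rule reaches_trans)
              fix s6 assume "L3 (nat (N - int n)) s6"
              then obtain I' R' where s6: "s6 = (24, I', R')" "good I'" "I' (-9) = int n"
                "\<And>j. j < n \<Longrightarrow> pot R' (int n) j = vec_mat n M v j"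
                using rdD(2) by (cases s6) (auto simp: L3_def)
              have "R' (101 + int c) = vec_mat n M v c" if c: "c < n" for c
              proof -
                \<comment> \<open>Among the names up to \<open>n\<close> only \<open>c + 1\<close>
                  has a nonzero entry in column \<open>c\<close>, so the invariant now says that its
                  register holds the answer for \<open>c\<close>.\<close>
                have "cf q c = (if q = int c + 1 then 1 else 0)" if q: "q \<in> {0..int n}" for q
                proof (cases "q = 0")
                  case False
                  then obtain c' where "q = int c' + 1" "c' < n"
                    using q by (intro that[of "nat (q - 1)"]) auto
                  then show ?thesis by (auto simp: rdD(5))
                qed (simp add: rdD(4))
                then have "pot R' (int n) c = (\<Sum>q\<in>{0..int n}. (if q = int c + 1 then 1 else 0) * R' (100 + q))"
                  unfolding pot_def by (intro sum.cong) auto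
                also have "\<dots> = R' (101 + int c)"
                  using c by (subst sum_indicator_times) (auto simp: add.commute add.left_commute)
                finally show ?thesis using s6(4)[OF c] by simp
              qed
              then have "L4 0 (43, I'(-9 := 0), R')"
                using s6 keep[of I' "I'(-9 := 0)"] B w by (auto simp: L4_def good_def)
              then have "after vec_query B 3 (L4 0) s6"
                unfolding s6(1) using s6(2,3) B w rdD(2,3) by (auto simp: good_def ready_def scalars_def after_step_numeral
                    after_step vec_query_def simp del: after.simps(2))
              from reaches_after[OF this order_refl]
              show "reaches vec_query B (8 * n + 5) s6 ?done"
              proof (rule reaches_trans)
                fix s7 assume s7: "L4 0 s7"
                have "reaches vec_query B (8 * n) s7 (L4 n)"
                  using step4 s7 by (intro reaches_loop) (auto simp: L4_def good_def)
                then show "reaches vec_query B (8 * n + 2) s7 ?done"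
                proof (rule reaches_trans)
                  fix s8 assume "L4 n s8"
                  then have "after vec_query B 2 ?done s8"
                    by (cases s8) (auto simp: L4_def good_def ready_def scalars_def after_step_numeral
                        after_step vec_query_def simp del: after.simps(2))
                  then show "reaches vec_query B 2 s8 ?done" by (rule reaches_after) simp
                qed simp
              qed simp
            qed (use rdD(2) in auto)
          qed simp
        qed simp
      qed simp
    qed simp
  qed simp
qed

section \<open>Halting runs and the choice of constants\<close>

lemma reaches_runs_within:
  assumes "reaches P B T s (\<lambda>(pc, I, R). pc = h \<and> \<Psi> I R)" "\<And>s. halted P (h, s)" "real_of_int B \<le> B'"
  obtains I R where "runs_within P s T B' (h, I, R)" "\<Psi> I R"
proof -
  obtain t I R where t: "t \<le> T" "run P t s = (h, I, R)" "\<Psi> I R"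
    "\<And>t'. t' \<le> t \<Longrightarrow> bnd B (fst (snd (run P t' s)))"
    using assms(1) unfolding reaches_def by (metis (mono_tags, lifting) case_prodE)
  have "\<bar>real_of_int (fst (snd (run P t' s)) x)\<bar> \<le> B'" if "t' \<le> t" for t' x
  proof -
    have "\<bar>fst (snd (run P t' s)) x\<bar> \<le> B" using t(4)[OF that] by (simp add: bnd_def)
    then have "real_of_int \<bar>fst (snd (run P t' s)) x\<bar> \<le> real_of_int B" by (simp only: of_int_le_iff)
    then show ?thesis using assms(3) by simp
  qed
  then have "runs_within P s T B' (h, I, R)"
    unfolding runs_within_def using t(1,2) assms(2) by metis
  then show ?thesis using that t(3) by blast
qed

text \<open>This keeps \<open>ln (n + 2)\<close> at or above 1/2, so that constant terms can be
  absorbed into multiples of the logarithm. It amounts to \<open>e \<le> 4\<close>.\<close>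

lemma half_le_ln2: "1 / 2 \<le> ln (2::real)"
proof -
  have "exp (1 / 2 :: real) ^ 2 = exp 1" by (simp flip: exp_of_nat_mult)
  also have "\<dots> \<le> 2 ^ 2" using exp_le by simp
  finally have "exp (1 / 2 :: real) \<le> 2" by (rule power2_le_imp_le) simp
  then show ?thesis by (subst ln_ge_iff) auto
qed

lemma halted_at: "halted preprocess (54, s)" "halted mat_query (40, s)" "halted vec_query (52, s)"
  by (simp_all add: halted_def preprocess_def mat_query_def vec_query_def)

theorem theorem2:
  "\<exists>(P :: instr list) (Q1 :: instr list) (Q2 :: instr list) (k :: nat) (c :: nat) (f :: nat \<Rightarrow> real).
     \<forall>n M d. twin_width n M = d \<longrightarrow>
       (\<exists>T s. real T \<le> f d * real (n + 2) ^ 2 * ln (real (n + 2)) ^ k \<and>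
          runs_within P (pre_init n M) T (f d * real (n + 2) ^ c) s \<and>
          (\<forall>v :: nat \<Rightarrow> real.
             (\<exists>T1 s1. real T1 \<le> f d * real (n + 2) * ln (real (n + 2)) ^ k \<and>
                runs_within Q1 (query_init n v s) T1 (f d * real (n + 2) ^ c) s1 \<and>
                (\<forall>i<n. out_reg s1 i = mat_vec n M v i)) \<and>
             (\<exists>T2 s2. real T2 \<le> f d * real (n + 2) * ln (real (n + 2)) ^ k \<and>
                runs_within Q2 (query_init n v s) T2 (f d * real (n + 2) ^ c) s2 \<and>
                (\<forall>j<n. out_reg s2 j = vec_mat n M v j))))"
proof -
  \<comment> \<open>The factor 200 covers three demands: 64 for the preprocessing time,
    \<open>22 * 6 + 40 = 172\<close> for the slower query and 105 for the word size.\<close>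
  define f where "f d = 200 * (real (d * 2 ^ d) + 1)" for d :: nat
  have main: "\<exists>T s. real T \<le> f d * real (n + 2) ^ 2 * ln (real (n + 2)) ^ 1 \<and>
          runs_within preprocess (pre_init n M) T (f d * real (n + 2) ^ 4) s \<and>
          (\<forall>v :: nat \<Rightarrow> real.
             (\<exists>T1 s1. real T1 \<le> f d * real (n + 2) * ln (real (n + 2)) ^ 1 \<and>
                runs_within mat_query (query_init n v s) T1 (f d * real (n + 2) ^ 4) s1 \<and>
                (\<forall>i<n. out_reg s1 i = mat_vec n M v i)) \<and>
             (\<exists>T2 s2. real T2 \<le> f d * real (n + 2) * ln (real (n + 2)) ^ 1 \<and>
                runs_within vec_query (query_init n v s) T2 (f d * real (n + 2) ^ 4) s2 \<and>
                (\<forall>j<n. out_reg s2 j = vec_mat n M v j)))"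
    if d: "twin_width n M = d" for n M d
  proof -
    define D where "D = real (d * 2 ^ d)"
    define L where "L = ln (real (n + 2))"
    define m where "m = real (n + 2)"
    \<comment> \<open>\<open>105 = 1 + 4 + 100\<close>, from
      \<open>wd n * wd n + 4 * wd n + 100\<close> with each of \<open>wd n * wd n\<close>,
      \<open>wd n\<close> and 1 at most \<open>(n + 2) ^ 4\<close>.\<close>
    define B where "B = 105 * (int n + 2) ^ 4"
    have D: "0 \<le> D" "f d = 200 * (D + 1)" by (simp_all add: D_def f_def)
    have "ln 2 \<le> L" unfolding L_def by (subst ln_le_cancel_iff) auto
    then have L: "1 / 2 \<le> L" using half_le_ln2 by linarith
    have m: "2 \<le> m" "real n = m - 2" by (simp_all add: m_def)
    have wd: "0 \<le> wd n" "wd n \<le> (int n + 2) ^ 2" by (simp_all add: wd_def power2_eq_square algebra_simps)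
    have "wd n * wd n \<le> (int n + 2) ^ 2 * (int n + 2) ^ 2" using wd by (intro mult_mono) auto
    also have "\<dots> = (int n + 2) ^ 4" by (simp flip: power_add)
    finally have ww: "wd n * wd n \<le> (int n + 2) ^ 4" .
    have "(int n + 2) ^ 2 \<le> (int n + 2) ^ 4" "1 \<le> (int n + 2) ^ 4"
      by (auto intro: power_increasing)
    then have B: "wd n * wd n + 4 * wd n + 100 \<le> B" using ww wd unfolding B_def by linarith
    have "0 \<le> wd n * wd n" by simp
    then have B4: "4 * wd n + 100 \<le> B" using B by linarith
    have BB: "real_of_int B \<le> f d * real (n + 2) ^ 4"
    proof -
      have "real_of_int B = 105 * m ^ 4" by (simp add: B_def m_def add.commute)
      also have "\<dots> \<le> f d * m ^ 4" unfolding D(2) using D(1) by (intro mult_right_mono) auto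
      finally show ?thesis by (simp add: m_def)
    qed
    obtain I R where s: "runs_within preprocess (pre_init n M) ((32 * n + 16) * n + 11)
        (f d * real (n + 2) ^ 4) (54, I, R)" and "bnd B I \<and> (\<exists>cf N. ready n M cf N I \<and>
        real_of_int N \<le> real n + real n * (real (d * 2 ^ d) * (2 * ln (real (n + 2)) / ln 2 + 1) + 2))"
      by (rule reaches_runs_within[OF preprocess_correct[OF B d] halted_at(1) BB])
    then obtain cf N where I: "bnd B I" "ready n M cf N I"
      and N: "real_of_int N \<le> real n + real n * (D * (2 * L / ln 2 + 1) + 2)"
      unfolding D_def L_def by blast
    \<comment> \<open>The 6 comes from \<open>2 * L / ln 2 \<le> 4 * L\<close> and
      \<open>1 \<le> 2 * L\<close>.\<close>
    have NL: "real_of_int N \<le> 6 * m * L * (D + 1)"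
    proof -
      have "1 / ln (2::real) \<le> 2" using half_le_ln2 by (simp add: field_simps)
      then have "2 * L * (1 / ln 2) \<le> 2 * L * 2" using L by (intro mult_left_mono) auto
      then have "2 * L / ln 2 + 1 \<le> 6 * L" using L by simp
      then have "D * (2 * L / ln 2 + 1) \<le> D * (6 * L)" using D(1) by (rule mult_left_mono)
      then have "1 + (D * (2 * L / ln 2 + 1) + 2) \<le> 6 * L * (D + 1)" using L by (simp add: algebra_simps)
      then have "real n * (1 + (D * (2 * L / ln 2 + 1) + 2)) \<le> real n * (6 * L * (D + 1))"
        by (rule mult_left_mono) simp
      also have "\<dots> \<le> m * (6 * L * (D + 1))" using L D m by (intro mult_right_mono) auto
      finally show ?thesis using N by (simp add: algebra_simps)
    qed
    have N0: "0 \<le> N" using I(2) by (auto simp: ready_def)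
    have mL: "m \<le> 2 * (m * L)" "0 \<le> m * L * D" using L m D by (auto simp: mult_le_cancel_left)
    have T: "real ((32 * n + 16) * n + 11) \<le> f d * real (n + 2) ^ 2 * L ^ 1"
    proof -
      have "real ((32 * n + 16) * n + 11) \<le> 32 * m ^ 2" by (simp add: m_def power2_eq_square algebra_simps)
      also have "\<dots> = 32 * m ^ 2 * 1" by simp
      also have "\<dots> \<le> 32 * m ^ 2 * (2 * L)" using L by (intro mult_left_mono) auto
      also have "\<dots> \<le> 200 * (D + 1) * m ^ 2 * L"
      proof -
        have "0 \<le> m ^ 2 * L" "0 \<le> m ^ 2 * L * D" using L D by auto
        then show ?thesis by (simp add: algebra_simps)
      qed
      finally show ?thesis unfolding D(2) by (simp add: m_def)
    qed
    have T2: "real (22 * nat N + 20 * n + 14) \<le> f d * real (n + 2) * L ^ 1"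
    proof -
      have "real (22 * nat N + 20 * n + 14) = 22 * real_of_int N + 20 * real n + 14" using N0 by simp
      also have "\<dots> \<le> 22 * (6 * m * L * (D + 1)) + 20 * m" using NL m by simp
      also have "\<dots> \<le> 200 * (D + 1) * m * L"
      proof -
        have e1: "22 * (6 * m * L * (D + 1)) = 132 * (m * L) + 132 * (m * L * D)"
          by (simp add: algebra_simps)
        have e2: "200 * (D + 1) * m * L = 200 * (m * L) + 200 * (m * L * D)"
          by (simp add: algebra_simps)
        show ?thesis unfolding e1 e2 using mL m(1) by linarith
      qed
      finally show ?thesis unfolding D(2) by (simp add: m_def)
    qed
    have "real (14 * nat N + 18 * n + 11) \<le> real (22 * nat N + 20 * n + 14)"
      by (rule of_nat_mono) simp
    then have T1: "real (14 * nat N + 18 * n + 11) \<le> f d * real (n + 2) * L ^ 1"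
      using T2 by (rule order_trans)
    have "(\<exists>T1 s1. real T1 \<le> f d * real (n + 2) * L ^ 1 \<and>
                runs_within mat_query (query_init n v (54, I, R)) T1 (f d * real (n + 2) ^ 4) s1 \<and>
                (\<forall>i<n. out_reg s1 i = mat_vec n M v i)) \<and>
          (\<exists>T2 s2. real T2 \<le> f d * real (n + 2) * L ^ 1 \<and>
                runs_within vec_query (query_init n v (54, I, R)) T2 (f d * real (n + 2) ^ 4) s2 \<and>
                (\<forall>j<n. out_reg s2 j = vec_mat n M v j))" for v
    proof -
      define R' where "R' = snd (snd (query_init n v (54, I, R)))"
      have q: "query_init n v (54, I, R) = (0, I, R')" "\<And>j. j < n \<Longrightarrow> R' (-int j - 1) = v j"
        by (simp_all add: R'_def query_init_def)
      obtain I1 R1 where s1: "runs_within mat_query (query_init n v (54, I, R)) (14 * nat N + 18 * n + 11)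
          (f d * real (n + 2) ^ 4) (40, I1, R1)" "\<forall>i<n. R1 (-int i - 1) = mat_vec n M v i"
        unfolding q(1)
        by (rule reaches_runs_within[OF mat_query_correct[where R = R' and v = v, OF I(2,1) B4 q(2)]
              halted_at(2) BB])
      obtain I2 R2 where s2: "runs_within vec_query (query_init n v (54, I, R)) (22 * nat N + 20 * n + 14)
          (f d * real (n + 2) ^ 4) (52, I2, R2)" "\<forall>j<n. R2 (-int j - 1) = vec_mat n M v j"
        unfolding q(1)
        by (rule reaches_runs_within[OF vec_query_correct[where R = R' and v = v, OF I(2,1) B4 q(2)]
              halted_at(3) BB])
      have "\<forall>i<n. out_reg (40, I1, R1) i = mat_vec n M v i"
        "\<forall>j<n. out_reg (52, I2, R2) j = vec_mat n M v j"
        using s1(2) s2(2) by (simp_all add: out_reg_def)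
      then show ?thesis using T1 T2 s1(1) s2(1) by blast
    qed
    then show ?thesis using T s unfolding L_def by blast
  qed
  show ?thesis
    by (rule exI[of _ preprocess], rule exI[of _ mat_query], rule exI[of _ vec_query],
        rule exI[of _ 1], rule exI[of _ 4], rule exI[of _ f], intro allI impI, rule main)
qed

end
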